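(* Let $j\in\mathbb{N}$, $h>0$, $\ell\in\{0,1\}$, $m\in\{1,2\}$ and $k_0>0$ be given. Then for each $M>0$ and $\delta>0$ there exists a constant $D_{M,\delta}>0$ (depending also on $j$, $k_0$, $h$, $L$, $\theta$) such that for all $(X,Y)$ with $-L\le X\le L$ and $-M<Y<M$, for all $k>0$ with $|k-k_0|<\delta$, and for all integers $N>1$, $$\Big|\sum_{n\in\mathbb{Z},\,|n|\ge N} e^{-i\alpha(k) nL}\,\partial_m^\ell G_{j,k}(X+nL,Y)\Big|\le\begin{cases} D_{M,\delta}\,N^{-\frac{j-1}{2}}, & j \text{ even},\\ D_{M,\delta}\,N^{-\frac{j}{2}}, & j\text{ odd}.\end{cases}$$ Consequently, for $\ell=0$ and for $\ell=1$ with $m=1,2$, the partial sums $\sum_{|n|\le N}e^{-i\alpha(k) nL}\partial_m^\ell G_{j,k}(X+nL,Y)$ converge as $N\to\infty$ (to $\partial_m^\ell G^q_{j,k}(X,Y)$), with truncation error $O(N^{-(j-1)/2})$ for even $j$ and $O(N^{-j/2})$ for odd $j$, uniformly in the stated ranges of $(X,Y)$ and $k$.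
   Context: Fix a period $L>0$ and an angle $\theta\in(-\pi/2,\pi/2)$; for $k>0$ set $\alpha(k)=k\sin\theta$. $H_0^{(1)}$ denotes the zeroth-order Hankel function of the first kind. For $j\in\mathbb{N}$ and $h>0$ the shifted Green function is $$G_{j,k}(X,Y)=\frac{i}{4}\sum_{\ell=0}^{j}(-1)^\ell\binom{j}{\ell}H_0^{(1)}\!\left(k\sqrt{X^2+(Y+\ell h)^2}\right),\qquad (X,Y)\ne(0,-\ell h),$$ and the shifted quasi-periodic Green function is $G^q_{j,k}(X,Y)=\sum_{n\in\mathbb{Z}}e^{-i\alpha(k) nL}G_{j,k}(X+nL,Y)$. $\partial_m^\ell$ denotes differentiation of order $\ell$ with respect to the $m$-th coordinate ($\partial_m^0$ is the identity). *)

theory Defs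
  imports "HOL-Analysis.Analysis"
begin

definition besselJ0 :: "real \<Rightarrow> real" where
  "besselJ0 x = (\<Sum>m. (-1) ^ m * (x / 2) ^ (2 * m) / (fact m)\<^sup>2)"

definition besselY0 :: "real \<Rightarrow> real" where
  "besselY0 x = (2 / pi) * (ln (x / 2) + euler_mascheroni) * besselJ0 x
     + (2 / pi) * (\<Sum>m. (-1) ^ m * harm (m + 1) * (x / 2) ^ (2 * (m + 1)) / (fact (m + 1))\<^sup>2)"

definition hankel01 :: "real \<Rightarrow> complex" where
  "hankel01 x = complex_of_real (besselJ0 x) + \<i> * complex_of_real (besselY0 x)"

definition alpha :: "real \<Rightarrow> real \<Rightarrow> real" where
  "alpha \<theta> k = k * sin \<theta>"

definition Gshift :: "nat \<Rightarrow> real \<Rightarrow> real \<Rightarrow> real \<Rightarrow> real \<Rightarrow> complex" where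
  "Gshift j h k X Y = (\<i> / 4) * (\<Sum>l\<le>j. (-1) ^ l * of_nat (j choose l)
       * hankel01 (k * sqrt (X\<^sup>2 + (Y + real l * h)\<^sup>2)))"

definition qterm :: "real \<Rightarrow> real \<Rightarrow> real \<Rightarrow> (real \<Rightarrow> real \<Rightarrow> complex) \<Rightarrow> real \<Rightarrow> real \<Rightarrow> int \<Rightarrow> complex" where
  "qterm L \<theta> k F X Y n = exp (- \<i> * complex_of_real (alpha \<theta> k * real_of_int n * L)) * F (X + real_of_int n * L) Y"

definition Gq :: "real \<Rightarrow> real \<Rightarrow> nat \<Rightarrow> real \<Rightarrow> real \<Rightarrow> real \<Rightarrow> real \<Rightarrow> complex" where
  "Gq L \<theta> j h k X Y = infsum (qterm L \<theta> k (Gshift j h k) X Y) UNIV"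

definition dpart :: "nat \<Rightarrow> nat \<Rightarrow> (real \<Rightarrow> real \<Rightarrow> complex) \<Rightarrow> real \<Rightarrow> real \<Rightarrow> complex" where
  "dpart l m F X Y = (if l = 0 then F X Y
     else if m = 1 then vector_derivative (\<lambda>t. F t Y) (at X)
     else vector_derivative (\<lambda>t. F X t) (at Y))"

definition dpart_exists :: "nat \<Rightarrow> nat \<Rightarrow> (real \<Rightarrow> real \<Rightarrow> complex) \<Rightarrow> real \<Rightarrow> real \<Rightarrow> bool" where
  "dpart_exists l m F X Y = (l = 0 \<or>
     (if m = 1 then (\<lambda>t. F t Y) differentiable (at X) else (\<lambda>t. F X t) differentiable (at Y)))"

end

theory Submission
  imports Defs
begin

text \<open>
  In the variable \<open>t = x\<^sup>2\<close> every solution \<open>g\<close> of Bessel's equation of order zero satisfies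
  \<open>t g'' + g' + g/4 = 0\<close>, and differentiating \<open>n\<close> times expresses \<open>t D^(n+2) g\<close> as
  \<open>- (n + 1) D^(n+1) g - D^n g / 4\<close>. An energy argument for \<open>g\<close> and \<open>g'\<close> followed by this
  recursion gives \<open>D^n g (t) = O(t^(-n) + t^(-n/2-1/4))\<close> on the half-line for \<open>n \<ge> 1\<close>, which
  after the scaling \<open>t = k\<^sup>2 (X\<^sup>2 + Y\<^sup>2)\<close> is uniform for bounded \<open>k > 0\<close>.
  The sum defining the shifted Green function is a \<open>j\<close>-th difference in \<open>Y\<close>, so it is controlled by
  the \<open>j\<close>-th \<open>Y\<close>-derivative, whose terms involve \<open>D^n g\<close> with \<open>n \<ge> j/2\<close> only; the terms of the
  quasi-periodic series therefore decay like \<open>\<bar>n\<bar>\<close> to the power \<open>- \<lceil>j/2\<rceil> - 1/2\<close>. First derivatives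
  in \<open>X\<close> and \<open>Y\<close> decay at least as fast, and the Weierstrass test justifies termwise
  differentiation.
\<close>

section \<open>Power series of the Bessel functions\<close>

text \<open>The operator \<open>t y'' + y'\<close> is \<open>(t y')'\<close>, which maps the power
  t^(n+1) to (n+1)^2 t^n. A differential equation for a power series thereby becomes a recursion
  between consecutive coefficients.\<close>

lemma power_series_ODE_operator:
  fixes c :: "nat \<Rightarrow> real"
  assumes "\<And>t. summable (\<lambda>n. c n * t ^ n)"
  shows "t * (\<Sum>n. diffs (diffs c) n * t ^ n) + (\<Sum>n. diffs c n * t ^ n)
      = (\<Sum>n. (real n + 1)\<^sup>2 * c (Suc n) * t ^ n)"
proof -
  note s1 = termdiff_converges_all[OF assms]
  note s2 = termdiff_converges_all[OF s1]
  have "summable (\<lambda>n. t * (diffs (diffs c) n * t ^ n))"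
    using s2 by (rule summable_mult)
  hence s3: "summable (\<lambda>n. real (Suc n) * diffs c (Suc n) * t ^ Suc n)"
    by (simp add: diffs_def mult_ac)
  have s4: "summable (\<lambda>n. real n * diffs c n * t ^ n)"
    using s3 by (subst (asm) summable_Suc_iff)
  have "t * (\<Sum>n. diffs (diffs c) n * t ^ n) = (\<Sum>n. t * (diffs (diffs c) n * t ^ n))"
    using s2 by (rule suminf_mult[symmetric])
  also have "\<dots> = (\<Sum>n. real (Suc n) * diffs c (Suc n) * t ^ Suc n)"
    by (simp add: diffs_def mult_ac)
  also have "\<dots> = (\<Sum>n. real n * diffs c n * t ^ n)"
    using suminf_split_head[OF s4] by simp
  finally have "t * (\<Sum>n. diffs (diffs c) n * t ^ n) + (\<Sum>n. diffs c n * t ^ n)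
     = (\<Sum>n. real n * diffs c n * t ^ n + diffs c n * t ^ n)"
    using suminf_add[OF s4 s1] by simp
  thus ?thesis by (simp add: diffs_def algebra_simps power2_eq_square)
qed

text \<open>Both series are taken in \<open>t = x\<^sup>2\<close>, in which \<open>J\<^sub>0\<close> is entire.\<close>

definition j0_coeff :: "nat \<Rightarrow> real" where
  "j0_coeff n = (-1) ^ n / (4 ^ n * (fact n)\<^sup>2)"

text \<open>These are the coefficients of what remains of (pi/2) Y_0 after removing J_0 times the
  logarithm plus Euler's constant. The constant coefficient vanishes because \<open>harm 0\<close>
  is 0.\<close>

definition y0_coeff :: "nat \<Rightarrow> real" where
  "y0_coeff n = - j0_coeff n * harm n"

lemma j0_coeff_Suc: "(real n + 1)\<^sup>2 * j0_coeff (Suc n) = - j0_coeff n / 4"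
proof -
  have "(real n + 1)\<^sup>2 \<noteq> 0" by (simp add: add_nonneg_eq_0_iff)
  thus ?thesis
    by (simp add: j0_coeff_def power_mult_distrib divide_simps)
qed

text \<open>The increment 1/(n+1) of the harmonic number adds the last term to the recursion of
  \<open>j0_coeff\<close>. That term is the n-th coefficient of minus the derivative of the J_0
  series.\<close>

lemma y0_coeff_Suc:
  "(real n + 1)\<^sup>2 * y0_coeff (Suc n) = - y0_coeff n / 4 - (real n + 1) * j0_coeff (Suc n)"
proof -
  have "(real n + 1)\<^sup>2 * y0_coeff (Suc n)
      = - ((real n + 1)\<^sup>2 * j0_coeff (Suc n)) * harm n - (real n + 1)\<^sup>2 * j0_coeff (Suc n) / (real n + 1)"
    by (simp add: y0_coeff_def harm_Suc field_simps)
  also have "(real n + 1)\<^sup>2 * j0_coeff (Suc n) / (real n + 1) = (real n + 1) * j0_coeff (Suc n)"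
    by (simp add: power2_eq_square)
  finally show ?thesis by (simp add: j0_coeff_Suc y0_coeff_def)
qed

lemma harm_le_of_nat: "harm n \<le> real n"
proof (induction n)
  case (Suc n)
  have "inverse (real (Suc n)) \<le> 1" by (simp add: field_simps)
  with Suc show ?case by (simp add: harm_Suc)
qed (simp add: harm_def)

lemma norm_j0_coeff_le: "\<bar>j0_coeff n\<bar> \<le> inverse (fact n)"
proof -
  have "1 * (1 * fact n) \<le> (4::real) ^ n * (fact n * fact n)"
    by (intro mult_mono) (auto simp: fact_ge_1)
  thus ?thesis
    by (simp add: j0_coeff_def abs_mult power2_eq_square field_simps)
qed

lemma norm_y0_coeff_le: "\<bar>y0_coeff n\<bar> \<le> inverse (fact n)"
proof -
  have "harm n \<le> (fact n :: real)"
    using harm_le_of_nat[of n] fact_ge_self[of n]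
    by (metis of_nat_fact of_nat_le_iff order_trans)
  moreover have "(0::real) \<le> harm n" by (rule harm_nonneg)
  ultimately have "harm n * (1 * fact n) \<le> (fact n :: real) * (4 ^ n * fact n)"
    by (intro mult_mono) auto
  hence "harm n / (4 ^ n * (fact n)\<^sup>2) \<le> inverse (fact n :: real)"
    by (simp add: power2_eq_square field_simps)
  thus ?thesis
    using harm_nonneg[of n, where 'a=real] by (simp add: y0_coeff_def j0_coeff_def abs_mult)
qed

lemma summable_exp_bounded:
  fixes c :: "nat \<Rightarrow> real"
  assumes "\<And>n. \<bar>c n\<bar> \<le> inverse (fact n)"
  shows "summable (\<lambda>n. c n * t ^ n)"
proof (rule summable_comparison_test')
  show "summable (\<lambda>n. inverse (fact n) * \<bar>t\<bar> ^ n)" by (rule summable_exp)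
  show "norm (c n * t ^ n) \<le> inverse (fact n) * \<bar>t\<bar> ^ n" if "n \<ge> 0" for n
    using assms[of n] by (simp add: abs_mult power_abs mult_right_mono)
qed

lemmas summable_j0 = summable_exp_bounded[OF norm_j0_coeff_le]
lemmas summable_y0 = summable_exp_bounded[OF norm_y0_coeff_le]

definition pser :: "(nat \<Rightarrow> real) \<Rightarrow> real \<Rightarrow> real" where
  "pser c t = (\<Sum>n. c n * t ^ n)"

lemma pser_deriv:
  assumes "\<And>t. summable (\<lambda>n. c n * t ^ n)"
  shows "(pser c has_field_derivative pser (diffs c) t) (at t)"
  unfolding pser_def[abs_def] by (rule termdiffs_strong_converges_everywhere[OF assms])

lemma pser_deriv2:
  assumes "\<And>t. summable (\<lambda>n. c n * t ^ n)"
  shows "(pser (diffs c) has_field_derivative pser (diffs (diffs c)) t) (at t)"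
  by (rule pser_deriv, rule termdiff_converges_all, rule assms)

lemma pser_j0_ODE:
  "t * pser (diffs (diffs j0_coeff)) t + pser (diffs j0_coeff) t = - pser j0_coeff t / 4"
proof -
  have "t * pser (diffs (diffs j0_coeff)) t + pser (diffs j0_coeff) t
      = (\<Sum>n. (-1/4) * (j0_coeff n * t ^ n))"
    unfolding pser_def power_series_ODE_operator[OF summable_j0] j0_coeff_Suc by simp
  also have "\<dots> = (-1/4) * pser j0_coeff t"
    unfolding pser_def by (rule suminf_mult[OF summable_j0])
  finally show ?thesis by simp
qed

text \<open>The inhomogeneity is the negative of what the operator produces when its derivatives
  fall on the logarithm multiplying J_0, so the two cancel in Y_0.\<close>

lemma pser_y0_ODE:
  "t * pser (diffs (diffs y0_coeff)) t + pser (diffs y0_coeff) t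
     = - pser y0_coeff t / 4 - pser (diffs j0_coeff) t"
proof -
  note s1 = summable_mult[OF summable_y0, of "-1/4" t]
  note s2 = termdiff_converges_all[OF summable_j0, of t]
  have "t * pser (diffs (diffs y0_coeff)) t + pser (diffs y0_coeff) t
      = (\<Sum>n. (-1/4) * (y0_coeff n * t ^ n) - diffs j0_coeff n * t ^ n)"
    unfolding pser_def power_series_ODE_operator[OF summable_y0] y0_coeff_Suc
    by (simp add: diffs_def algebra_simps)
  also have "\<dots> = (\<Sum>n. (-1/4) * (y0_coeff n * t ^ n)) - pser (diffs j0_coeff) t"
    unfolding pser_def by (rule suminf_diff[OF s1 s2, symmetric])
  also have "(\<Sum>n. (-1/4) * (y0_coeff n * t ^ n)) = (-1/4) * pser y0_coeff t"
    unfolding pser_def by (rule suminf_mult[OF summable_y0])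
  finally show ?thesis by simp
qed

section \<open>J_0 and Y_0 as solutions of Bessel's equation in the squared variable\<close>

definition gJ :: "real \<Rightarrow> real" where "gJ = pser j0_coeff"
definition gJ' :: "real \<Rightarrow> real" where "gJ' = pser (diffs j0_coeff)"

text \<open>For t = x^2 with x > 0, the expression \<open>ln (t / 4) / 2\<close> is
  \<open>ln (x / 2)\<close>.\<close>

definition gY :: "real \<Rightarrow> real" where
  "gY t = (2 / pi) * ((ln (t / 4) / 2 + euler_mascheroni) * pser j0_coeff t + pser y0_coeff t)"

definition gY' :: "real \<Rightarrow> real" where
  "gY' t = (2 / pi) * (pser j0_coeff t / (2 * t)
     + (ln (t / 4) / 2 + euler_mascheroni) * pser (diffs j0_coeff) t + pser (diffs y0_coeff) t)"

lemma besselJ0_conv_gJ: "besselJ0 x = gJ (x\<^sup>2)"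
proof -
  have "(-1) ^ n * (x / 2) ^ (2 * n) / (fact n)\<^sup>2 = j0_coeff n * (x\<^sup>2) ^ n" for n
    by (simp add: j0_coeff_def power_divide power_mult)
  thus ?thesis unfolding besselJ0_def gJ_def pser_def by simp
qed

lemma besselY0_conv_gY:
  assumes "x > 0"
  shows "besselY0 x = gY (x\<^sup>2)"
proof -
  have e: "(-1) ^ n * harm (n + 1) * (x / 2) ^ (2 * (n + 1)) / (fact (n + 1))\<^sup>2
      = y0_coeff (Suc n) * (x\<^sup>2) ^ Suc n" for n
  proof -
    have "(x / 2) ^ (2 * (n + 1)) = (x\<^sup>2) ^ Suc n / 4 ^ Suc n"
      by (simp only: power_mult power_divide Suc_eq_plus1) (simp add: power_divide)
    thus ?thesis
      unfolding y0_coeff_def j0_coeff_def by simp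
  qed
  \<comment> \<open>The series in \<open>besselY0\<close> starts at the quadratic term; prepending
    the zero coefficient \<open>y0_coeff 0\<close> makes it a full power series.\<close>
  have "(\<Sum>n. (-1) ^ n * harm (n + 1) * (x / 2) ^ (2 * (n + 1)) / (fact (n + 1))\<^sup>2) = pser y0_coeff (x\<^sup>2)"
    unfolding e pser_def suminf_split_head[OF summable_y0] by (simp add: y0_coeff_def harm_def)
  moreover have "ln (x\<^sup>2 / 4) / 2 = ln (x / 2)"
    using assms ln_realpow[of "x / 2" 2] by (simp add: power_divide)
  ultimately show ?thesis
    unfolding besselY0_def gY_def besselJ0_conv_gJ gJ_def by (simp add: algebra_simps)
qed

text \<open>The derivative clauses encode t g'' + g' + g/4 = 0 as a first-order system. The crude
  bound C/t near the origin leaves room for the logarithm in Y_0 and for the 1/t in its derivative,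
  so J_0 and Y_0 can share one argument.\<close>

definition bessel_solution :: "(real \<Rightarrow> real) \<Rightarrow> (real \<Rightarrow> real) \<Rightarrow> bool" where
  "bessel_solution g g' \<longleftrightarrow>
     (\<forall>t>0. (g has_real_derivative g' t) (at t)
          \<and> (g' has_real_derivative - (g' t + g t / 4) / t) (at t))
   \<and> (\<exists>C. \<forall>t. 0 < t \<and> t \<le> 1 \<longrightarrow> \<bar>g t\<bar> \<le> C / t \<and> \<bar>g' t\<bar> \<le> C / t)"

lemma continuous_bounded_unit_interval:
  fixes f :: "real \<Rightarrow> real"
  assumes "\<And>t. isCont f t"
  obtains B where "B \<ge> 0" "\<And>t. 0 < t \<Longrightarrow> t \<le> 1 \<Longrightarrow> \<bar>f t\<bar> \<le> B"
proof -
  have "compact (f ` {0..1})"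
    using assms by (intro compact_continuous_image) (auto intro: continuous_at_imp_continuous_on)
  then obtain B where "\<And>y. y \<in> f ` {0..1} \<Longrightarrow> norm y \<le> B"
    using compact_imp_bounded bounded_iff by metis
  then have "\<bar>f t\<bar> \<le> \<bar>B\<bar>" if "0 < t" "t \<le> 1" for t
    using that by (metis abs_ge_self atLeastAtMost_iff image_eqI less_imp_le order_trans real_norm_def)
  thus ?thesis using that[of "\<bar>B\<bar>"] by auto
qed

lemma pser_j0_bounds:
  obtains B where "B \<ge> 0"
    "\<And>t. 0 < t \<Longrightarrow> t \<le> 1 \<Longrightarrow> \<bar>pser j0_coeff t\<bar> \<le> B"
    "\<And>t. 0 < t \<Longrightarrow> t \<le> 1 \<Longrightarrow> \<bar>pser (diffs j0_coeff) t\<bar> \<le> B"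
    "\<And>t. 0 < t \<Longrightarrow> t \<le> 1 \<Longrightarrow> \<bar>pser y0_coeff t\<bar> \<le> B"
    "\<And>t. 0 < t \<Longrightarrow> t \<le> 1 \<Longrightarrow> \<bar>pser (diffs y0_coeff) t\<bar> \<le> B"
proof -
  note c = pser_deriv[OF summable_j0, THEN DERIV_isCont] pser_deriv2[OF summable_j0, THEN DERIV_isCont]
    pser_deriv[OF summable_y0, THEN DERIV_isCont] pser_deriv2[OF summable_y0, THEN DERIV_isCont]
  obtain B1 where "B1 \<ge> 0" "\<And>t. 0 < t \<Longrightarrow> t \<le> 1 \<Longrightarrow> \<bar>pser j0_coeff t\<bar> \<le> B1"
    using continuous_bounded_unit_interval[OF c(1)] by blast
  moreover obtain B2 where "B2 \<ge> 0" "\<And>t. 0 < t \<Longrightarrow> t \<le> 1 \<Longrightarrow> \<bar>pser (diffs j0_coeff) t\<bar> \<le> B2"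
    using continuous_bounded_unit_interval[OF c(2)] by blast
  moreover obtain B3 where "B3 \<ge> 0" "\<And>t. 0 < t \<Longrightarrow> t \<le> 1 \<Longrightarrow> \<bar>pser y0_coeff t\<bar> \<le> B3"
    using continuous_bounded_unit_interval[OF c(3)] by blast
  moreover obtain B4 where "B4 \<ge> 0" "\<And>t. 0 < t \<Longrightarrow> t \<le> 1 \<Longrightarrow> \<bar>pser (diffs y0_coeff) t\<bar> \<le> B4"
    using continuous_bounded_unit_interval[OF c(4)] by blast
  ultimately show ?thesis
    by (intro that[of "B1 + B2 + B3 + B4"]; force)
qed

lemma bessel_solution_J: "bessel_solution gJ gJ'"
  unfolding bessel_solution_def
proof (intro conjI allI impI)
  fix t :: real assume t: "t > 0"
  show "(gJ has_real_derivative gJ' t) (at t)"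
    unfolding gJ_def gJ'_def by (rule pser_deriv[OF summable_j0])
  have "pser (diffs (diffs j0_coeff)) t = - (gJ' t + gJ t / 4) / t"
    using pser_j0_ODE[of t] t unfolding gJ_def gJ'_def by (simp add: field_simps)
  thus "(gJ' has_real_derivative - (gJ' t + gJ t / 4) / t) (at t)"
    using pser_deriv2[OF summable_j0, of t] unfolding gJ_def gJ'_def by simp
next
  obtain B where B: "B \<ge> 0" "\<And>t. 0 < t \<Longrightarrow> t \<le> 1 \<Longrightarrow> \<bar>gJ t\<bar> \<le> B"
    "\<And>t. 0 < t \<Longrightarrow> t \<le> 1 \<Longrightarrow> \<bar>gJ' t\<bar> \<le> B"
    unfolding gJ_def gJ'_def using pser_j0_bounds by metis
  have "B \<le> B / t" if "0 < t" "t \<le> 1" for t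
    using that B(1) by (simp add: field_simps mult_left_le)
  hence "\<forall>t. 0 < t \<and> t \<le> 1 \<longrightarrow> \<bar>gJ t\<bar> \<le> B / t \<and> \<bar>gJ' t\<bar> \<le> B / t"
    using B(2,3) by (meson order_trans)
  thus "\<exists>C. \<forall>t. 0 < t \<and> t \<le> 1 \<longrightarrow> \<bar>gJ t\<bar> \<le> C / t \<and> \<bar>gJ' t\<bar> \<le> C / t" by blast
qed

text \<open>The logarithm contributes the extra term P' to t g'' + g', where P is the J_0 series,
  and the power series part contributes -P'. The remaining terms satisfy the homogeneous
  equation.\<close>

lemma bessel_solution_Y: "bessel_solution gY gY'"
  unfolding bessel_solution_def
proof (intro conjI allI impI)
  fix t :: real assume t: "t > 0"
  note d = pser_deriv[OF summable_j0] pser_deriv2[OF summable_j0]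
    pser_deriv[OF summable_y0] pser_deriv2[OF summable_y0]
  show "(gY has_real_derivative gY' t) (at t)"
    unfolding gY_def[abs_def] gY'_def
    using t by (auto intro!: derivative_eq_intros d simp: field_simps)
  define P where "P = pser j0_coeff t"
  define P1 where "P1 = pser (diffs j0_coeff) t"
  define P2 where "P2 = pser (diffs (diffs j0_coeff)) t"
  define Q where "Q = pser y0_coeff t"
  define Q1 where "Q1 = pser (diffs y0_coeff) t"
  define Q2 where "Q2 = pser (diffs (diffs y0_coeff)) t"
  define l where "l = ln (t / 4) / 2 + (euler_mascheroni :: real)"
  have 1: "P2 = - (P1 + P / 4) / t"
    using pser_j0_ODE[of t] t unfolding P_def P1_def P2_def by (simp add: field_simps)
  have 2: "Q2 = - (Q1 + Q / 4 + P1) / t"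
    using pser_y0_ODE[of t] t unfolding P_def P1_def P2_def Q_def Q1_def Q2_def by (simp add: field_simps)
  \<comment> \<open>Of the two equal summands, one comes from differentiating P in P/(2t), the other
    from differentiating the logarithm in front of P1.\<close>
  have "(gY' has_real_derivative (2 / pi) * (P1 / (2 * t) - P / (2 * t ^ 2) + P1 / (2 * t) + l * P2 + Q2)) (at t)"
    unfolding gY'_def[abs_def] P_def P1_def P2_def Q2_def l_def
    using t by (auto intro!: derivative_eq_intros d simp: field_simps power2_eq_square)
  also have "(2 / pi) * (P1 / (2 * t) - P / (2 * t ^ 2) + P1 / (2 * t) + l * P2 + Q2) = - (gY' t + gY t / 4) / t"
    unfolding gY'_def gY_def l_def[symmetric] P_def[symmetric] P1_def[symmetric] Q_def[symmetric]
      Q1_def[symmetric] 1 2 using t by (simp add: field_simps power2_eq_square)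
  finally show "(gY' has_real_derivative - (gY' t + gY t / 4) / t) (at t)" .
next
  obtain B where B: "B \<ge> 0"
    "\<And>t. 0 < t \<Longrightarrow> t \<le> 1 \<Longrightarrow> \<bar>pser j0_coeff t\<bar> \<le> B"
    "\<And>t. 0 < t \<Longrightarrow> t \<le> 1 \<Longrightarrow> \<bar>pser (diffs j0_coeff) t\<bar> \<le> B"
    "\<And>t. 0 < t \<Longrightarrow> t \<le> 1 \<Longrightarrow> \<bar>pser y0_coeff t\<bar> \<le> B"
    "\<And>t. 0 < t \<Longrightarrow> t \<le> 1 \<Longrightarrow> \<bar>pser (diffs y0_coeff) t\<bar> \<le> B"
    using pser_j0_bounds by blast
  \<comment> \<open>The 2 comes from ln u \<le> u - 1 at u = 4/t, which bounds half the logarithm by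
    2/t. In \<open>C\<close>, the first \<open>B\<close> pays for J_0/(2t) in \<open>gY'\<close>,
    \<open>E * B\<close> for the logarithmic term and the last \<open>B\<close> for the power series
    part.\<close>
  define E where "E = 2 + \<bar>euler_mascheroni :: real\<bar>"
  define C where "C = (2 / pi) * (B + E * B + B)"
  have main: "\<bar>gY t\<bar> \<le> C / t \<and> \<bar>gY' t\<bar> \<le> C / t" if t: "0 < t" "t \<le> 1" for t
  proof -
    have "ln (4 / t) \<le> 4 / t - 1" using t by (intro ln_le_minus_one) auto
    moreover have "ln (4 / t) = - ln (t / 4)" "ln (t / 4) \<le> 0" using t by (auto simp: ln_div)
    ultimately have "\<bar>ln (t / 4) / 2\<bar> \<le> 2 / t" by simp
    moreover have "\<bar>euler_mascheroni :: real\<bar> \<le> \<bar>euler_mascheroni\<bar> / t"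
      using t mult_left_le_one_le[of "\<bar>euler_mascheroni :: real\<bar>" t] by (simp add: field_simps)
    ultimately have l: "\<bar>ln (t / 4) / 2 + (euler_mascheroni::real)\<bar> \<le> E / t"
      unfolding E_def add_divide_distrib by linarith
    have Bt: "B \<le> B / t" using t B(1) by (simp add: field_simps mult_left_le)
    have lp: "\<bar>(ln (t / 4) / 2 + euler_mascheroni) * p\<bar> \<le> E * B / t" if "\<bar>p\<bar> \<le> B" for p
      using mult_mono[OF l that] t B(1) unfolding E_def by (simp add: abs_mult)
    have "\<bar>(ln (t / 4) / 2 + euler_mascheroni) * pser j0_coeff t + pser y0_coeff t\<bar> \<le> (B + E * B + B) / t"
      using lp[OF B(2)[OF t]] B(4)[OF t] Bt B(1) unfolding add_divide_distrib by linarith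
    hence 1: "\<bar>gY t\<bar> \<le> C / t"
      unfolding gY_def C_def abs_mult times_divide_eq_right[symmetric]
      by (intro mult_mono) auto
    have "\<bar>pser j0_coeff t / (2 * t)\<bar> \<le> B / t"
      using B(1) B(2)[OF t] t by (simp add: field_simps)
    hence "\<bar>pser j0_coeff t / (2 * t) + (ln (t / 4) / 2 + euler_mascheroni) * pser (diffs j0_coeff) t
        + pser (diffs y0_coeff) t\<bar> \<le> (B + E * B + B) / t"
      using lp[OF B(3)[OF t]] B(5)[OF t] Bt B(1) unfolding add_divide_distrib by linarith
    hence 2: "\<bar>gY' t\<bar> \<le> C / t"
      unfolding gY'_def C_def abs_mult times_divide_eq_right[symmetric]
      by (intro mult_mono) auto
    show ?thesis using 1 2 by simp
  qed
  thus "\<exists>C. \<forall>t. 0 < t \<and> t \<le> 1 \<longrightarrow> \<bar>gY t\<bar> \<le> C / t \<and> \<bar>gY' t\<bar> \<le> C / t" by blast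
qed

section \<open>Decay of derivatives\<close>

text \<open>
  \<open>\<surd>t (4 t g'\<^sup>2 + 2 g g' + g\<^sup>2 + g\<^sup>2/(2t))\<close> is the energy \<open>v'\<^sup>2 + (1 + 1/(4x\<^sup>2)) v\<^sup>2\<close> of the Liouville
  normal form \<open>v(x) = \<surd>x g(x\<^sup>2)\<close>, which satisfies \<open>v'' + (1 + 1/(4x\<^sup>2)) v = 0\<close>; it decreases because
  the potential does.
\<close>

lemma bessel_energy_decreasing:
  assumes sol: "bessel_solution g g'" and "0 < a" "a \<le> b"
  defines "E \<equiv> \<lambda>t. sqrt t * (4 * t * (g' t)\<^sup>2 + 2 * g t * g' t + (g t)\<^sup>2 + (g t)\<^sup>2 / (2 * t))"
  shows "E b \<le> E a"
proof (rule DERIV_nonpos_imp_nonincreasing[OF \<open>a \<le> b\<close>])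
  fix t assume "a \<le> t" "t \<le> b"
  hence t: "t > 0" using \<open>0 < a\<close> by simp
  have d: "(g has_real_derivative g' t) (at t)"
    "(g' has_real_derivative - (g' t + g t / 4) / t) (at t)"
    using sol t unfolding bessel_solution_def by auto
  \<comment> \<open>Substituting t = r^2 turns the derivative computation into an identity of
    rational functions.\<close>
  define r where "r = sqrt t"
  have r: "r > 0" "t = r\<^sup>2" using t by (simp_all add: r_def)
  \<comment> \<open>In the normal form the energy changes only through the potential, at rate
    -v^2/(2x^3) in x; dx/dt = 1/(2x) and v^2 = x g^2 give this value.\<close>
  have "(E has_real_derivative - (g t)\<^sup>2 / (4 * t * sqrt t)) (at t)"
    unfolding E_def r_def[symmetric]
    apply (rule derivative_eq_intros d refl | use t in simp; fail)+
    apply (simp add: r_def[symmetric])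
    apply (simp add: r(2))
    using r(1) apply (simp add: field_simps power2_eq_square)
    apply (simp add: power4_eq_xxxx algebra_simps)
    done
  moreover have "- (g t)\<^sup>2 / (4 * t * sqrt t) \<le> 0" using t by simp
  ultimately show "\<exists>y. (E has_real_derivative y) (at t) \<and> y \<le> 0" by blast
qed

text \<open>Completing the square absorbs the cross term 2 g g' of the energy and leaves
  \<open>sqrt t * (2 * t * (g' t)\<^sup>2 + (g t)\<^sup>2)\<close>, which therefore stays below the
  energy at 1. Each of its two summands gives one of the rates.\<close>

lemma bessel_solution_decay:
  assumes sol: "bessel_solution g g'"
  shows "\<exists>C\<ge>0. \<forall>t\<ge>1. \<bar>g t\<bar> \<le> C * t powr (-1/4) \<and> \<bar>g' t\<bar> \<le> C * t powr (-3/4)"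
proof -
  define E where "E = (\<lambda>t. sqrt t * (4 * t * (g' t)\<^sup>2 + 2 * g t * g' t + (g t)\<^sup>2 + (g t)\<^sup>2 / (2 * t)))"
  have main: "sqrt t * (2 * t * (g' t)\<^sup>2 + (g t)\<^sup>2) \<le> E 1" if t: "t \<ge> 1" for t
  proof -
    have "0 \<le> (2 * t * g' t + g t)\<^sup>2 / (2 * t)" using t by simp
    also have "\<dots> = 2 * t * (g' t)\<^sup>2 + 2 * g t * g' t + (g t)\<^sup>2 / (2 * t)"
      using t by (simp add: power2_eq_square field_simps)
    finally have "2 * t * (g' t)\<^sup>2 + (g t)\<^sup>2 \<le> 4 * t * (g' t)\<^sup>2 + 2 * g t * g' t + (g t)\<^sup>2 + (g t)\<^sup>2 / (2 * t)"
      by simp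
    hence "sqrt t * (2 * t * (g' t)\<^sup>2 + (g t)\<^sup>2) \<le> E t"
      unfolding E_def using t by (intro mult_left_mono) auto
    also have "E t \<le> E 1"
      unfolding E_def using t by (intro bessel_energy_decreasing[OF sol]) auto
    finally show ?thesis .
  qed
  define C where "C = sqrt (E 1)"
  have "E 1 \<ge> 0" proof -
    have "0 \<le> sqrt 1 * (2 * 1 * (g' 1)\<^sup>2 + (g 1)\<^sup>2)" by simp
    also have "\<dots> \<le> E 1" by (rule main) simp
    finally show ?thesis .
  qed
  hence C: "C \<ge> 0" "C\<^sup>2 = E 1" by (auto simp: C_def)
  have rt: "sqrt t = t powr (1/2)" if "t \<ge> 1" for t :: real
    using that by (simp add: powr_half_sqrt)
  have g: "\<bar>g t\<bar> \<le> C * t powr (-1/4)" if t: "t \<ge> 1" for t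
  proof (rule power2_le_imp_le)
    have "sqrt t * (g t)\<^sup>2 \<le> sqrt t * (2 * t * (g' t)\<^sup>2 + (g t)\<^sup>2)"
      using t by (intro mult_left_mono) auto
    with main[OF t] have "sqrt t * (g t)\<^sup>2 \<le> C\<^sup>2" using C by simp
    hence "(g t)\<^sup>2 \<le> C\<^sup>2 / sqrt t" using t by (simp add: field_simps)
    also have "\<dots> = (C * t powr (-1/4))\<^sup>2"
      unfolding rt[OF t] using t by (simp add: power_mult_distrib power_divide powr_minus_divide powr_power)
    finally show "\<bar>g t\<bar>\<^sup>2 \<le> (C * t powr (-1/4))\<^sup>2" by simp
  qed (use C in auto)
  have g': "\<bar>g' t\<bar> \<le> C * t powr (-3/4)" if t: "t \<ge> 1" for t
  proof (rule power2_le_imp_le)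
    have "sqrt t * (t * (g' t)\<^sup>2) \<le> sqrt t * (2 * t * (g' t)\<^sup>2 + (g t)\<^sup>2)"
      using t by (intro mult_left_mono) auto
    with main[OF t] have "sqrt t * (t * (g' t)\<^sup>2) \<le> C\<^sup>2" using C by simp
    hence "(g' t)\<^sup>2 \<le> C\<^sup>2 / (sqrt t * t)" using t by (simp add: field_simps)
    also have "sqrt t * t = t powr (3/2)"
      unfolding rt[OF t] using t by (simp add: powr_mult_base mult.commute)
    also have "C\<^sup>2 / t powr (3/2) = (C * t powr (-3/4))\<^sup>2"
      using t by (simp add: power_mult_distrib power_divide powr_minus_divide powr_power)
    finally show "\<bar>g' t\<bar>\<^sup>2 \<le> (C * t powr (-3/4))\<^sup>2" by simp
  qed (use C in auto)
  show ?thesis using C(1) g g' by blast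
qed

section \<open>Higher derivatives of a solution and their bounds near zero and infinity\<close>

fun bessel_derivs :: "(real \<Rightarrow> real) \<Rightarrow> (real \<Rightarrow> real) \<Rightarrow> nat \<Rightarrow> real \<Rightarrow> real" where
  "bessel_derivs g g' 0 t = g t"
| "bessel_derivs g g' (Suc 0) t = g' t"
| "bessel_derivs g g' (Suc (Suc n)) t =
     - ((real n + 1) * bessel_derivs g g' (Suc n) t + bessel_derivs g g' n t / 4) / t"

lemma bessel_derivs_has_derivative:
  assumes sol: "bessel_solution g g'" and t: "t > 0"
  shows "(bessel_derivs g g' n has_real_derivative bessel_derivs g g' (Suc n) t) (at t)"
proof (induction n rule: induct_nat_012)
  case 0
  have "bessel_derivs g g' 0 = g" by (rule ext) simp
  thus ?case using sol t by (simp add: bessel_solution_def)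
next
  case 1
  have "bessel_derivs g g' (Suc 0) = g'" by (rule ext) simp
  thus ?case using sol t by (simp add: bessel_solution_def)
next
  case (ge2 n)
  define d where "d = bessel_derivs g g'"
  have e: "bessel_derivs g g' (Suc (Suc n)) = (\<lambda>t. - ((real n + 1) * d (Suc n) t + d n t / 4) / t)"
    by (rule ext) (simp add: d_def)
  \<comment> \<open>Differentiating the quotient leaves the numerator once undifferentiated.
    Replacing it by minus t times the derivative of order n + 2 supplies the extra 1 that raises the
    coefficient n + 1 to n + 2.\<close>
  have e1: "(real n + 1) * d (Suc n) t + d n t / 4 = - d (Suc (Suc n)) t * t"
    using t by (simp add: d_def)
  have "((\<lambda>t. - ((real n + 1) * d (Suc n) t + d n t / 4) / t) has_real_derivative
      (- ((real n + 1) * d (Suc (Suc n)) t + d (Suc n) t / 4) * t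
        + ((real n + 1) * d (Suc n) t + d n t / 4)) / (t * t)) (at t)"
    using t by (auto intro!: derivative_eq_intros ge2[folded d_def] simp: field_simps)
  also have "(- ((real n + 1) * d (Suc (Suc n)) t + d (Suc n) t / 4) * t
        + ((real n + 1) * d (Suc n) t + d n t / 4)) / (t * t)
      = - ((real (Suc n) + 1) * d (Suc (Suc n)) t + d (Suc n) t / 4) / t"
    unfolding e1 using t by (simp add: field_simps)
  finally show ?case unfolding e by (simp add: d_def)
qed

text \<open>Each use of the recursion divides by t, so every order costs one power of t. The
  exponent is \<open>max n 1\<close> because \<open>g\<close> itself is only bounded by C/t.\<close>

lemma bessel_derivs_bound_small:
  assumes sol: "bessel_solution g g'"
  shows "\<exists>C\<ge>0. \<forall>t. 0 < t \<and> t \<le> 1 \<longrightarrow> \<bar>bessel_derivs g g' n t\<bar> \<le> C * t powr - real (max n 1)"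
proof (induction n rule: induct_nat_012)
  case 0
  obtain C where C: "\<And>t. 0 < t \<Longrightarrow> t \<le> 1 \<Longrightarrow> \<bar>g t\<bar> \<le> C / t"
    using sol unfolding bessel_solution_def by blast
  have "C \<ge> 0" using C[of 1] by simp
  thus ?case using C by (auto simp: powr_minus_divide)
next
  case 1
  obtain C where C: "\<And>t. 0 < t \<Longrightarrow> t \<le> 1 \<Longrightarrow> \<bar>g' t\<bar> \<le> C / t"
    using sol unfolding bessel_solution_def by blast
  have "C \<ge> 0" using C[of 1] by simp
  thus ?case using C by (auto simp: powr_minus_divide)
next
  case (ge2 n)
  then obtain C1 C2 where C: "C1 \<ge> 0" "C2 \<ge> 0"
    "\<And>t. 0 < t \<Longrightarrow> t \<le> 1 \<Longrightarrow> \<bar>bessel_derivs g g' n t\<bar> \<le> C1 * t powr - real (max n 1)"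
    "\<And>t. 0 < t \<Longrightarrow> t \<le> 1 \<Longrightarrow> \<bar>bessel_derivs g g' (Suc n) t\<bar> \<le> C2 * t powr - real (Suc n)"
    by auto
  have "\<bar>bessel_derivs g g' (Suc (Suc n)) t\<bar> \<le> ((real n + 1) * C2 + C1) * t powr - real (Suc (Suc n))"
    if t: "0 < t" "t \<le> 1" for t
  proof -
    have "t powr - real (max n 1) \<le> t powr - real (Suc n)"
      using t by (intro powr_mono') auto
    hence "\<bar>bessel_derivs g g' n t\<bar> \<le> C1 * t powr - real (Suc n)"
      using C(3)[OF t] mult_left_mono[OF _ C(1)] order_trans by blast
    moreover have "\<bar>(real n + 1) * bessel_derivs g g' (Suc n) t\<bar> \<le> (real n + 1) * (C2 * t powr - real (Suc n))"
      using C(4)[OF t] by (simp add: abs_mult mult_left_mono)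
    ultimately have "\<bar>(real n + 1) * bessel_derivs g g' (Suc n) t + bessel_derivs g g' n t / 4\<bar>
        \<le> ((real n + 1) * C2 + C1) * t powr - real (Suc n)"
      unfolding distrib_right by (simp only: mult.assoc)
    hence "\<bar>bessel_derivs g g' (Suc (Suc n)) t\<bar> \<le> ((real n + 1) * C2 + C1) * t powr - real (Suc n) / t"
      unfolding bessel_derivs.simps abs_divide abs_minus_cancel using t by (simp add: divide_right_mono)
    also have "\<dots> = ((real n + 1) * C2 + C1) * (t powr - real (Suc n) / t)"
      by (rule times_divide_eq_right[symmetric])
    also have "t powr - real (Suc n) / t = t powr - real (Suc (Suc n))"
      using t powr_diff[of t "- real (Suc n)" 1] by (simp add: algebra_simps)
    finally show ?thesis .
  qed
  moreover have "(real n + 1) * C2 + C1 \<ge> 0" using C by simp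
  ultimately show ?case by (intro exI[of _ "(real n + 1) * C2 + C1"]) simp
qed

text \<open>For large t the division by t is a gain of one power per two orders: the term with the
  derivative two orders lower dominates, and the intermediate one decays faster.\<close>

lemma bessel_derivs_bound_large:
  assumes sol: "bessel_solution g g'"
  shows "\<exists>C\<ge>0. \<forall>t\<ge>1. \<bar>bessel_derivs g g' n t\<bar> \<le> C * t powr (- real n / 2 - 1/4)"
proof (induction n rule: induct_nat_012)
  case 0
  show ?case using bessel_solution_decay[OF sol] by auto
next
  case 1
  show ?case using bessel_solution_decay[OF sol] by auto
next
  case (ge2 n)
  then obtain C1 C2 where C: "C1 \<ge> 0" "C2 \<ge> 0"
    "\<And>t. t \<ge> 1 \<Longrightarrow> \<bar>bessel_derivs g g' n t\<bar> \<le> C1 * t powr (- real n / 2 - 1/4)"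
    "\<And>t. t \<ge> 1 \<Longrightarrow> \<bar>bessel_derivs g g' (Suc n) t\<bar> \<le> C2 * t powr (- real (Suc n) / 2 - 1/4)"
    by blast
  have "\<bar>bessel_derivs g g' (Suc (Suc n)) t\<bar> \<le> ((real n + 1) * C2 + C1) * t powr (- real (Suc (Suc n)) / 2 - 1/4)"
    if t: "t \<ge> 1" for t
  proof -
    define e where "e = - real n / 2 - 1/4"
    have "t powr (- real (Suc n) / 2 - 1/4) \<le> t powr e"
      unfolding e_def using t by (intro powr_mono) auto
    hence "\<bar>bessel_derivs g g' (Suc n) t\<bar> \<le> C2 * t powr e"
      using C(4)[OF t] mult_left_mono[OF _ C(2)] order_trans by blast
    hence "\<bar>(real n + 1) * bessel_derivs g g' (Suc n) t\<bar> \<le> (real n + 1) * (C2 * t powr e)"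
      by (simp add: abs_mult mult_left_mono)
    with C(3)[OF t, folded e_def]
    have "\<bar>(real n + 1) * bessel_derivs g g' (Suc n) t + bessel_derivs g g' n t / 4\<bar>
        \<le> ((real n + 1) * C2 + C1) * t powr e"
      unfolding distrib_right by (simp only: mult.assoc)
    hence "\<bar>bessel_derivs g g' (Suc (Suc n)) t\<bar> \<le> ((real n + 1) * C2 + C1) * t powr e / t"
      unfolding bessel_derivs.simps abs_divide abs_minus_cancel using t by (simp add: divide_right_mono)
    also have "\<dots> = ((real n + 1) * C2 + C1) * (t powr e / t)"
      by (rule times_divide_eq_right[symmetric])
    also have "t powr e / t = t powr (e - 1)"
      using t by (simp add: powr_diff)
    also have "e - 1 = - real (Suc (Suc n)) / 2 - 1/4" by (simp add: e_def field_simps)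
    finally show ?thesis .
  qed
  moreover have "(real n + 1) * C2 + C1 \<ge> 0" using C by simp
  ultimately show ?case by blast
qed

text \<open>Adding the two majorants gives one bound on the whole half-line, so the argument may
  later be scaled by k^2 without asking on which side of 1 it falls.\<close>

lemma bessel_derivs_bound:
  assumes sol: "bessel_solution g g'" and n: "n \<ge> 1"
  shows "\<exists>C\<ge>0. \<forall>t>0. \<bar>bessel_derivs g g' n t\<bar>
           \<le> C * (t powr - real n + t powr (- real n / 2 - 1/4))"
proof -
  obtain C1 where C1: "C1 \<ge> 0" "\<And>t. 0 < t \<Longrightarrow> t \<le> 1 \<Longrightarrow> \<bar>bessel_derivs g g' n t\<bar> \<le> C1 * t powr - real n"
    using bessel_derivs_bound_small[OF sol, of n] n by (auto simp: max_def)
  obtain C2 where C2: "C2 \<ge> 0" "\<And>t. 1 \<le> t \<Longrightarrow> \<bar>bessel_derivs g g' n t\<bar> \<le> C2 * t powr (- real n / 2 - 1/4)"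
    using bessel_derivs_bound_large[OF sol, of n] by blast
  have "\<bar>bessel_derivs g g' n t\<bar> \<le> (C1 + C2) * (t powr - real n + t powr (- real n / 2 - 1/4))" if "t > 0" for t
  proof (cases "t \<le> 1")
    case True
    have "C1 * t powr - real n \<le> (C1 + C2) * (t powr - real n + t powr (- real n / 2 - 1/4))"
      using C1(1) C2(1) by (intro mult_mono) auto
    with C1(2)[OF that True] show ?thesis by linarith
  next
    case False
    have "C2 * t powr (- real n / 2 - 1/4) \<le> (C1 + C2) * (t powr - real n + t powr (- real n / 2 - 1/4))"
      using C1(1) C2(1) by (intro mult_mono) auto
    with C2(2)[of t] False show ?thesis by linarith
  qed
  thus ?thesis using C1(1) C2(1) by (intro exI[of _ "C1 + C2"]) auto
qed

text \<open>For t > 0 this is the n-th derivative of \<open>hankel01 (sqrt t)\<close> with respect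
  to t.\<close>

definition hankel_deriv :: "nat \<Rightarrow> real \<Rightarrow> complex" where
  "hankel_deriv n t = Complex (bessel_derivs gJ gJ' n t) (bessel_derivs gY gY' n t)"

lemma hankel_deriv_has_vector_derivative:
  "t > 0 \<Longrightarrow> (hankel_deriv n has_vector_derivative hankel_deriv (Suc n) t) (at t)"
  using bessel_derivs_has_derivative[OF bessel_solution_J, of t n]
    bessel_derivs_has_derivative[OF bessel_solution_Y, of t n]
  unfolding has_vector_derivative_complex_iff hankel_deriv_def[abs_def]
  by (simp add: has_real_derivative_iff_has_vector_derivative)

lemma hankel01_conv_hankel_deriv: "x > 0 \<Longrightarrow> hankel01 x = hankel_deriv 0 (x\<^sup>2)"
  by (simp add: hankel01_def hankel_deriv_def besselJ0_conv_gJ besselY0_conv_gY complex_eq_iff)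

lemma hankel_deriv_bound:
  assumes "n \<ge> 1"
  shows "\<exists>C\<ge>0. \<forall>t>0. norm (hankel_deriv n t) \<le> C * (t powr - real n + t powr (- real n / 2 - 1/4))"
proof -
  define f where "f t = t powr - real n + t powr (- real n / 2 - 1/4)" for t :: real
  obtain C1 C2 where C: "C1 \<ge> 0" "C2 \<ge> 0"
    "\<And>t. t > 0 \<Longrightarrow> \<bar>bessel_derivs gJ gJ' n t\<bar> \<le> C1 * f t"
    "\<And>t. t > 0 \<Longrightarrow> \<bar>bessel_derivs gY gY' n t\<bar> \<le> C2 * f t"
    unfolding f_def using bessel_derivs_bound[OF bessel_solution_J assms] bessel_derivs_bound[OF bessel_solution_Y assms]
    by metis
  have "norm (hankel_deriv n t) \<le> (C1 + C2) * f t" if "t > 0" for t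
    using C(3,4)[OF that] cmod_le[of "hankel_deriv n t"]
    by (simp add: hankel_deriv_def distrib_right)
  thus ?thesis using C(1,2) unfolding f_def by (intro exI[of _ "C1 + C2"]) auto
qed

text \<open>The factor k^(2n) cancels the k-dependence of the majorant t^(-n) exactly, and in the
  other majorant it leaves k^(n - 1/2), bounded by its value at \<open>K\<close>. The bound is
  therefore uniform down to k = 0.\<close>

lemma scaled_hankel_deriv_bound:
  assumes n: "n \<ge> 1" and "K > 0" "c > 0"
  shows "\<exists>C\<ge>0. \<forall>k x y. 0 < k \<and> k \<le> K \<and> c \<le> \<bar>x\<bar> \<longrightarrow>
     norm (k ^ (2 * n) *\<^sub>R hankel_deriv n (k\<^sup>2 * (x\<^sup>2 + y\<^sup>2))) \<le> C * \<bar>x\<bar> powr (- real n - 1/2)"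
proof -
  define e where "e = - real n / 2 - 1/4"
  define B where "B = (c\<^sup>2) powr (- real n - e) + K powr (2 * n + 2 * e)"
  obtain C where C: "C \<ge> 0" "\<And>t. t > 0 \<Longrightarrow> norm (hankel_deriv n t) \<le> C * (t powr - real n + t powr e)"
    unfolding e_def using hankel_deriv_bound[OF n] by blast
  have B: "B \<ge> 0" by (simp add: B_def)
  have main: "norm (k ^ (2 * n) *\<^sub>R hankel_deriv n (k\<^sup>2 * (x\<^sup>2 + y\<^sup>2))) \<le> (C * B) * \<bar>x\<bar> powr (- real n - 1/2)"
    if k: "0 < k" "k \<le> K" and x: "c \<le> \<bar>x\<bar>" for k x y
  proof -
    define s where "s = x\<^sup>2 + y\<^sup>2"
    have x0: "\<bar>x\<bar> > 0" using x \<open>c > 0\<close> by linarith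
    hence x2: "x\<^sup>2 > 0" by simp
    have cs: "c\<^sup>2 \<le> x\<^sup>2" using x \<open>c > 0\<close> by (simp add: abs_le_square_iff[symmetric])
    have s: "s > 0" "c\<^sup>2 \<le> s" "x\<^sup>2 \<le> s"
      unfolding s_def using x2 cs zero_le_power2[of y] by linarith+
    have k2: "k ^ (2 * n) = k powr (2 * n)"
      by (rule powr_realpow[OF k(1), symmetric])
    have ks: "(k\<^sup>2 * s) powr a = k powr (2 * a) * s powr a" for a
      using powr_powr[of k 2 a] k s by (simp add: powr_mult)
    have "norm (k ^ (2 * n) *\<^sub>R hankel_deriv n (k\<^sup>2 * s))
        \<le> k ^ (2 * n) * (C * ((k\<^sup>2 * s) powr - real n + (k\<^sup>2 * s) powr e))"
      using C(2)[of "k\<^sup>2 * s"] k s by (simp add: mult_left_mono)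
    also have "\<dots> = C * (k powr (2 * n) * (k\<^sup>2 * s) powr - real n + k powr (2 * n) * (k\<^sup>2 * s) powr e)"
      unfolding k2 by (simp only: distrib_left mult.left_commute mult.assoc mult.commute[of C])
    also have "k powr (2 * n) * (k\<^sup>2 * s) powr - real n = s powr - real n"
      unfolding ks using k(1) by (simp add: powr_add[symmetric] mult.assoc[symmetric])
    also have "k powr (2 * n) * (k\<^sup>2 * s) powr e = k powr (2 * n + 2 * e) * s powr e"
      unfolding ks by (simp add: powr_add)
    \<comment> \<open>The surplus exponent is 1/4 - n/2, which is negative for n \<ge> 1, so this
      factor is at most its value at c^2.\<close>
    also have "s powr - real n = s powr (- real n - e) * s powr e"
      using s by (simp add: powr_add[symmetric])
    also have "C * (s powr (- real n - e) * s powr e + k powr (2 * n + 2 * e) * s powr e)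
        \<le> C * (((c\<^sup>2) powr (- real n - e) + K powr (2 * n + 2 * e)) * s powr e)"
    proof (intro mult_left_mono C(1))
      have "s powr (- real n - e) \<le> (c\<^sup>2) powr (- real n - e)"
        using s \<open>c > 0\<close> n by (intro powr_mono2') (auto simp: e_def field_simps)
      moreover have "k powr (2 * n + 2 * e) \<le> K powr (2 * n + 2 * e)"
        using k n by (intro powr_mono2) (auto simp: e_def field_simps)
      ultimately show "s powr (- real n - e) * s powr e + k powr (2 * n + 2 * e) * s powr e
          \<le> ((c\<^sup>2) powr (- real n - e) + K powr (2 * n + 2 * e)) * s powr e"
        unfolding distrib_right by (intro add_mono mult_right_mono) auto
    qed
    also have "\<dots> = C * B * s powr e" by (simp add: B_def)
    also have "\<dots> \<le> C * B * (x\<^sup>2) powr e"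
      using s x2 C(1) B n by (intro mult_left_mono powr_mono2') (auto simp: e_def)
    also have "(x\<^sup>2) powr e = \<bar>x\<bar> powr (- real n - 1/2)"
      using x0 powr_realpow[of "\<bar>x\<bar>" 2] powr_powr[of "\<bar>x\<bar>" 2 e] by (simp add: e_def algebra_simps)
    finally show ?thesis by (simp add: s_def)
  qed
  thus ?thesis using C(1) B by (intro exI[of _ "C * B"]) auto
qed

section \<open>Differences of the Green function\<close>

text \<open>The mean value equality fails for complex-valued functions; this inequality replaces it
  in estimating a difference by a derivative.\<close>

lemma vector_mean_value_bound:
  fixes f :: "real \<Rightarrow> 'a :: real_normed_vector"
  assumes "a \<le> b"
    and "\<And>t. a \<le> t \<Longrightarrow> t \<le> b \<Longrightarrow> (f has_vector_derivative f' t) (at t)"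
    and "\<And>t. a \<le> t \<Longrightarrow> t \<le> b \<Longrightarrow> norm (f' t) \<le> B"
  shows "norm (f b - f a) \<le> B * (b - a)"
proof -
  have "norm (f b - f a) \<le> B * norm (b - a)"
  proof (rule differentiable_bound[where S = "{a..b}" and f' = "\<lambda>t x. x *\<^sub>R f' t"])
    fix t assume t: "t \<in> {a..b}"
    show "(f has_derivative (\<lambda>x. x *\<^sub>R f' t)) (at t within {a..b})"
      using assms(2)[of t] t unfolding has_vector_derivative_def by (auto intro: has_derivative_at_withinI)
    show "onorm (\<lambda>x. x *\<^sub>R f' t) \<le> B"
    proof (rule onorm_bound)
      show "B \<ge> 0" using order_trans[OF norm_ge_zero assms(3)[of t]] t by simp
      show "norm (x *\<^sub>R f' t) \<le> B * norm x" for x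
        using mult_left_mono[OF assms(3)[of t], of "\<bar>x\<bar>"] t by (simp add: mult.commute)
    qed
  qed (use assms in auto)
  thus ?thesis using assms(1) by simp
qed

text \<open>This is the j-th power of the operator taking f to f(y) - f(y + h), that is, (-1)^j
  times the j-th forward difference.\<close>

definition shiftdiff :: "nat \<Rightarrow> real \<Rightarrow> (real \<Rightarrow> complex) \<Rightarrow> real \<Rightarrow> complex" where
  "shiftdiff j h f y = (\<Sum>l\<le>j. (-1) ^ l * of_nat (j choose l) * f (y + real l * h))"

lemma shiftdiff_0 [simp]: "shiftdiff 0 h f y = f y"
  by (simp add: shiftdiff_def)

text \<open>Pascal's rule. Peeling off one order exhibits a plain difference to which the mean value
  inequality applies.\<close>

lemma shiftdiff_Suc: "shiftdiff (Suc j) h f y = shiftdiff j h f y - shiftdiff j h f (y + h)"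
proof -
  define g where "g l = f (y + real l * h)" for l
  have "shiftdiff (Suc j) h f y = (\<Sum>l\<le>Suc j. (-1) ^ l * of_nat (Suc j choose l) * g l)"
    by (simp add: shiftdiff_def g_def)
  also have "\<dots> = g 0 + (\<Sum>l\<le>j. (-1) ^ Suc l * of_nat (Suc j choose Suc l) * g (Suc l))"
    by (subst sum.atMost_Suc_shift) simp
  also have "\<dots> = (g 0 + (\<Sum>l\<le>j. (-1) ^ Suc l * of_nat (j choose Suc l) * g (Suc l)))
      - (\<Sum>l\<le>j. (-1) ^ l * of_nat (j choose l) * g (Suc l))"
    by (simp add: sum_subtractf[symmetric] sum.distrib[symmetric] algebra_simps sum_negf)
  \<comment> \<open>The sum now runs one index too far, but the last coefficient,
    \<open>j choose Suc j\<close>, is zero.\<close>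
  also have "g 0 + (\<Sum>l\<le>j. (-1) ^ Suc l * of_nat (j choose Suc l) * g (Suc l))
      = (\<Sum>l\<le>Suc j. (-1) ^ l * of_nat (j choose l) * g l)"
    by (subst sum.atMost_Suc_shift) simp
  also have "\<dots> = shiftdiff j h f y"
    by (simp add: shiftdiff_def g_def)
  also have "(\<Sum>l\<le>j. (-1) ^ l * of_nat (j choose l) * g (Suc l)) = shiftdiff j h f (y + h)"
    by (simp add: shiftdiff_def g_def algebra_simps)
  finally show ?thesis .
qed

lemma shiftdiff_add: "shiftdiff j h (\<lambda>y. f y + g y) y = shiftdiff j h f y + shiftdiff j h g y"
  by (simp add: shiftdiff_def sum.distrib algebra_simps)

lemma shiftdiff_mult: "shiftdiff j h (\<lambda>y. c * f y) y = c * shiftdiff j h f y"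
  by (simp add: shiftdiff_def sum_distrib_left mult_ac)

lemma shiftdiff_has_vector_derivative:
  assumes "\<And>t. (f has_vector_derivative f' t) (at t)"
  shows "(shiftdiff j h f has_vector_derivative shiftdiff j h f' y) (at y)"
proof -
  have "((\<lambda>y. f (y + real l * h)) has_vector_derivative f' (y + real l * h)) (at y)" for l
  proof -
    have "((\<lambda>y. y + real l * h) has_vector_derivative 1) (at y)"
      by (auto intro!: derivative_eq_intros)
    from vector_diff_chain_at[OF this assms] show ?thesis by (simp add: o_def)
  qed
  thus ?thesis
    unfolding shiftdiff_def[abs_def] by (intro has_vector_derivative_sum has_vector_derivative_mult_right)
qed

text \<open>The linear span of these functions is closed under differentiation in y. The power of k
  collects the chain rule factors and is the one under which the bounds are uniform in k.\<close>

definition hankel_monomial :: "real \<Rightarrow> nat \<Rightarrow> nat \<Rightarrow> real \<Rightarrow> real \<Rightarrow> complex" where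
  "hankel_monomial k a b x y = of_real (y ^ a * k ^ (2 * b)) * hankel_deriv b (k\<^sup>2 * (x\<^sup>2 + y\<^sup>2))"

text \<open>The inner derivative 2 k^2 y raises both indices by one. For a = 0 the truncated
  \<open>a - 1\<close> is harmless, since its coefficient is zero.\<close>

lemma hankel_monomial_has_vector_derivative:
  assumes k: "k > 0" and s: "x\<^sup>2 + y\<^sup>2 > 0"
  shows "(hankel_monomial k a b x has_vector_derivative
     of_nat a * hankel_monomial k (a - 1) b x y + 2 * hankel_monomial k (a + 1) (b + 1) x y) (at y)"
proof -
  have "((\<lambda>y. k\<^sup>2 * (x\<^sup>2 + y\<^sup>2)) has_vector_derivative k\<^sup>2 * (2 * y)) (at y)"
    by (auto intro!: derivative_eq_intros simp: has_real_derivative_iff_has_vector_derivative[symmetric])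
  from vector_diff_chain_at[OF this hankel_deriv_has_vector_derivative] k s
  have 1: "((\<lambda>y. hankel_deriv b (k\<^sup>2 * (x\<^sup>2 + y\<^sup>2))) has_vector_derivative
      (k\<^sup>2 * (2 * y)) *\<^sub>R hankel_deriv (Suc b) (k\<^sup>2 * (x\<^sup>2 + y\<^sup>2))) (at y)"
    by (simp add: o_def)
  have "((\<lambda>y. y ^ a * k ^ (2 * b)) has_real_derivative real a * y ^ (a - 1) * k ^ (2 * b)) (at y)"
    by (auto intro!: derivative_eq_intros)
  hence 2: "((\<lambda>y. complex_of_real (y ^ a * k ^ (2 * b))) has_vector_derivative
      complex_of_real (real a * y ^ (a - 1) * k ^ (2 * b))) (at y)"
    by (rule has_vector_derivative_of_real)
  show ?thesis
    unfolding hankel_monomial_def[abs_def]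
    by (rule has_vector_derivative_eq_rhs[OF has_vector_derivative_mult[OF 2 1]])
       (simp add: scaleR_conv_of_real algebra_simps power2_eq_square)
qed

text \<open>The natural exponent belongs to b; since |x| stays above c it may be weakened to any p
  \<le> b. All monomials arising from repeated differentiation can then share one exponent.\<close>

lemma hankel_monomial_bound:
  assumes b: "b \<ge> 1" and "K > 0" "c > 0" and p: "p \<le> b" and M: "M \<ge> 0"
  shows "\<exists>C\<ge>0. \<forall>k x y. 0 < k \<and> k \<le> K \<and> c \<le> \<bar>x\<bar> \<and> \<bar>y\<bar> \<le> M \<longrightarrow>
     norm (hankel_monomial k a b x y) \<le> C * \<bar>x\<bar> powr (- real p - 1/2)"
proof -
  obtain C where C: "C \<ge> 0" "\<And>k x y. 0 < k \<Longrightarrow> k \<le> K \<Longrightarrow> c \<le> \<bar>x\<bar> \<Longrightarrow>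
     norm (k ^ (2 * b) *\<^sub>R hankel_deriv b (k\<^sup>2 * (x\<^sup>2 + y\<^sup>2))) \<le> C * \<bar>x\<bar> powr (- real b - 1/2)"
    using scaled_hankel_deriv_bound[OF b \<open>K > 0\<close> \<open>c > 0\<close>] by blast
  define D where "D = c powr (real p - real b)"
  have "norm (hankel_monomial k a b x y) \<le> (M ^ a * (C * D)) * \<bar>x\<bar> powr (- real p - 1/2)"
    if k: "0 < k" "k \<le> K" and x: "c \<le> \<bar>x\<bar>" and y: "\<bar>y\<bar> \<le> M" for k x y
  proof -
    have "norm (hankel_monomial k a b x y)
        = \<bar>y\<bar> ^ a * norm (k ^ (2 * b) *\<^sub>R hankel_deriv b (k\<^sup>2 * (x\<^sup>2 + y\<^sup>2)))"
      by (simp add: hankel_monomial_def norm_mult norm_power power_abs abs_mult)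
    also have "\<dots> \<le> M ^ a * (C * \<bar>x\<bar> powr (- real b - 1/2))"
      using C(2)[OF k x] y M by (intro mult_mono power_mono) auto
    also have "\<bar>x\<bar> powr (- real b - 1/2) = \<bar>x\<bar> powr (real p - real b) * \<bar>x\<bar> powr (- real p - 1/2)"
      by (simp add: powr_add[symmetric])
    also have "\<dots> \<le> D * \<bar>x\<bar> powr (- real p - 1/2)"
      unfolding D_def using x \<open>c > 0\<close> p by (intro mult_right_mono powr_mono2') auto
    finally show ?thesis using C(1) M by (simp add: mult_left_mono mult.assoc)
  qed
  moreover have "M ^ a * (C * D) \<ge> 0" using C(1) M by (simp add: D_def)
  ultimately show ?thesis by blast
qed

text \<open>
  Differentiating \<open>y\<^sup>a H\<^sub>b\<close> in \<open>y\<close> raises the weight \<open>2b - a\<close> by one, and \<open>a \<ge> 0\<close> bounds \<open>b\<close>, which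
  governs the decay in \<open>x\<close>, from below by half the weight.
\<close>

lemma shiftdiff_hankel_monomial_bound:
  assumes "h > 0" "K > 0" "c > 0"
  shows "b \<ge> 1 \<or> (a = 0 \<and> j \<ge> 1) \<Longrightarrow> 2 * p + a \<le> 2 * b + j + 1 \<Longrightarrow> M \<ge> 0 \<Longrightarrow>
    \<exists>C\<ge>0. \<forall>k x y. 0 < k \<and> k \<le> K \<and> c \<le> \<bar>x\<bar> \<and> \<bar>y\<bar> \<le> M \<longrightarrow>
     norm (shiftdiff j h (hankel_monomial k a b x) y) \<le> C * \<bar>x\<bar> powr (- real p - 1/2)"
proof (induction j arbitrary: a b M)
  case 0
  \<comment> \<open>For j = 0 the premises leave only b \<ge> 1, and 2p + a \<le> 2b + 1 gives p
    \<le> b by integrality.\<close>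
  thus ?case using hankel_monomial_bound[of b K c p M a] assms by simp
next
  case (Suc j)
  \<comment> \<open>The mean value inequality evaluates the derivative between y and y + h, so the
    induction hypothesis is used on the wider strip of half-width M + h.\<close>
  have M': "M + h \<ge> 0" using Suc.prems assms by simp
  obtain C1 where C1: "C1 \<ge> 0" "\<And>k x y. 0 < k \<Longrightarrow> k \<le> K \<Longrightarrow> c \<le> \<bar>x\<bar> \<Longrightarrow> \<bar>y\<bar> \<le> M + h \<Longrightarrow>
     norm (of_nat a * shiftdiff j h (hankel_monomial k (a - 1) b x) y) \<le> C1 * \<bar>x\<bar> powr (- real p - 1/2)"
  proof (cases "a = 0")
    case True
    thus ?thesis using that[of 0] by simp
  next
    case False
    \<comment> \<open>A nonzero a forces b \<ge> 1, which persists. The decrease of a makes up for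
      the lost order of difference in the weight condition.\<close>
    hence "b \<ge> 1 \<or> (a - 1 = 0 \<and> j \<ge> 1)" "2 * p + (a - 1) \<le> 2 * b + j + 1"
      using Suc.prems by auto
    from Suc.IH[OF this M'] obtain C where C: "C \<ge> 0"
      "\<And>k x y. 0 < k \<Longrightarrow> k \<le> K \<Longrightarrow> c \<le> \<bar>x\<bar> \<Longrightarrow> \<bar>y\<bar> \<le> M + h \<Longrightarrow>
        norm (shiftdiff j h (hankel_monomial k (a - 1) b x) y) \<le> C * \<bar>x\<bar> powr (- real p - 1/2)"
      by blast
    show ?thesis
      using C by (intro that[of "real a * C"]) (auto simp: norm_mult mult.assoc mult_left_mono)
  qed
  \<comment> \<open>Raising both indices increases 2b - a by one, again matching the lost order.
    Starting from b = 0, this is the step that reaches the derivatives for which decay is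
    known.\<close>
  have "b + 1 \<ge> 1 \<or> (a + 1 = 0 \<and> j \<ge> 1)" "2 * p + (a + 1) \<le> 2 * (b + 1) + j + 1"
    using Suc.prems by auto
  from Suc.IH[OF this M'] obtain C2 where C2: "C2 \<ge> 0"
    "\<And>k x y. 0 < k \<Longrightarrow> k \<le> K \<Longrightarrow> c \<le> \<bar>x\<bar> \<Longrightarrow> \<bar>y\<bar> \<le> M + h \<Longrightarrow>
      norm (shiftdiff j h (hankel_monomial k (a + 1) (b + 1) x) y) \<le> C2 * \<bar>x\<bar> powr (- real p - 1/2)"
    by blast
  have "norm (shiftdiff (Suc j) h (hankel_monomial k a b x) y) \<le> ((C1 + 2 * C2) * h) * \<bar>x\<bar> powr (- real p - 1/2)"
    if k: "0 < k" "k \<le> K" and x: "c \<le> \<bar>x\<bar>" and y: "\<bar>y\<bar> \<le> M" for k x y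
  proof -
    have "x\<^sup>2 > 0" using x \<open>c > 0\<close> by auto
    hence s: "x\<^sup>2 + t\<^sup>2 > 0" for t by (simp add: add_pos_nonneg)
    define f' where "f' t = of_nat a * hankel_monomial k (a - 1) b x t
       + 2 * hankel_monomial k (a + 1) (b + 1) x t" for t
    have "norm (shiftdiff j h (hankel_monomial k a b x) (y + h) - shiftdiff j h (hankel_monomial k a b x) y)
        \<le> (C1 * \<bar>x\<bar> powr (- real p - 1/2) + 2 * (C2 * \<bar>x\<bar> powr (- real p - 1/2))) * (y + h - y)"
    proof (rule vector_mean_value_bound)
      show "(shiftdiff j h (hankel_monomial k a b x) has_vector_derivative shiftdiff j h f' t) (at t)" for t
        unfolding f'_def by (intro shiftdiff_has_vector_derivative hankel_monomial_has_vector_derivative k s)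
      fix t assume "y \<le> t" "t \<le> y + h"
      hence t: "\<bar>t\<bar> \<le> M + h" using y by linarith
      have "norm (shiftdiff j h f' t) \<le> norm (of_nat a * shiftdiff j h (hankel_monomial k (a - 1) b x) t)
          + 2 * norm (shiftdiff j h (hankel_monomial k (a + 1) (b + 1) x) t)"
        unfolding f'_def shiftdiff_add shiftdiff_mult
        by (rule order_trans[OF norm_triangle_ineq]) (simp add: norm_mult)
      with C1(2)[OF k x t] C2(2)[OF k x t]
      show "norm (shiftdiff j h f' t)
          \<le> C1 * \<bar>x\<bar> powr (- real p - 1/2) + 2 * (C2 * \<bar>x\<bar> powr (- real p - 1/2))" by linarith
    qed (use \<open>h > 0\<close> in simp)
    thus ?thesis by (simp add: shiftdiff_Suc norm_minus_commute algebra_simps)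
  qed
  moreover have "(C1 + 2 * C2) * h \<ge> 0" using C1(1) C2(1) \<open>h > 0\<close> by simp
  ultimately show ?case by blast
qed

section \<open>The shifted Green function and its first partial derivatives\<close>

definition Gshift_regular :: "nat \<Rightarrow> real \<Rightarrow> real \<Rightarrow> real \<Rightarrow> bool" where
  "Gshift_regular j h x y \<longleftrightarrow> (\<forall>l\<le>j. x\<^sup>2 + (y + real l * h)\<^sup>2 > 0)"

text \<open>Closed forms for the value and the two first derivatives. The factor x commutes with
  shifts in y and stands outside the difference, whereas y + l h varies with the shift and must stay
  inside, as the index a = 1.\<close>

definition Gshift_deriv :: "nat \<Rightarrow> nat \<Rightarrow> nat \<Rightarrow> real \<Rightarrow> real \<Rightarrow> real \<Rightarrow> real \<Rightarrow> complex" where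
  "Gshift_deriv l m j h k x y = (\<i> / 4) *
     (if l = 0 then shiftdiff j h (hankel_monomial k 0 0 x) y
      else if m = 1 then 2 * of_real x * shiftdiff j h (hankel_monomial k 0 1 x) y
      else 2 * shiftdiff j h (hankel_monomial k 1 1 x) y)"

lemma hankel01_has_vector_derivative:
  assumes u: "(u has_real_derivative u') (at t)" and "u t > 0" "k > 0"
  shows "((\<lambda>t. hankel01 (k * sqrt (u t))) has_vector_derivative
      of_real (k\<^sup>2 * u') * hankel_deriv 1 (k\<^sup>2 * u t)) (at t)"
proof -
  have "((\<lambda>s. k\<^sup>2 * s) has_vector_derivative k\<^sup>2) (at (u t))"
    unfolding has_real_derivative_iff_has_vector_derivative[symmetric]
    by (auto intro!: derivative_eq_intros)
  from vector_diff_chain_at[OF this hankel_deriv_has_vector_derivative[of _ 0]] assms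
  have "((\<lambda>s. hankel_deriv 0 (k\<^sup>2 * s)) has_vector_derivative k\<^sup>2 *\<^sub>R hankel_deriv 1 (k\<^sup>2 * u t)) (at (u t))"
    by (simp add: o_def)
  \<comment> \<open>The identification with \<open>hankel_deriv 0\<close> holds for positive
    arguments only, hence the transfer on the open half-line.\<close>
  hence "((\<lambda>s. hankel01 (k * sqrt s)) has_vector_derivative k\<^sup>2 *\<^sub>R hankel_deriv 1 (k\<^sup>2 * u t)) (at (u t))"
    by (rule has_vector_derivative_transform_within_open[of _ _ _ "{0<..}"])
       (use assms in \<open>auto simp: hankel01_conv_hankel_deriv power_mult_distrib\<close>)
  from vector_diff_chain_at[OF u[unfolded has_real_derivative_iff_has_vector_derivative] this]
  show ?thesis by (simp add: o_def scaleR_conv_of_real mult_ac)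
qed

lemma Gshift_eq:
  assumes "Gshift_regular j h x y" "k > 0"
  shows "Gshift j h k x y = Gshift_deriv 0 m j h k x y"
proof -
  have "hankel01 (k * sqrt (x\<^sup>2 + (y + real l * h)\<^sup>2)) = hankel_monomial k 0 0 x (y + real l * h)" if "l \<le> j" for l
    using assms that
    by (simp add: Gshift_regular_def hankel_monomial_def hankel01_conv_hankel_deriv power_mult_distrib)
  thus ?thesis
    by (simp add: Gshift_def Gshift_deriv_def shiftdiff_def)
qed

lemma Gshift_has_vector_derivative_fst:
  assumes "Gshift_regular j h x y" "k > 0"
  shows "((\<lambda>t. Gshift j h k t y) has_vector_derivative Gshift_deriv 1 1 j h k x y) (at x)"
proof -
  have "((\<lambda>t. hankel01 (k * sqrt (t\<^sup>2 + (y + real l * h)\<^sup>2))) has_vector_derivative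
     of_real (k\<^sup>2 * (2 * x)) * hankel_deriv 1 (k\<^sup>2 * (x\<^sup>2 + (y + real l * h)\<^sup>2))) (at x)" if "l \<le> j" for l
    by (rule hankel01_has_vector_derivative)
       (use assms that in \<open>auto simp: Gshift_regular_def intro!: derivative_eq_intros\<close>)
  hence "((\<lambda>t. Gshift j h k t y) has_vector_derivative (\<i> / 4) * (\<Sum>l\<le>j. (-1) ^ l * of_nat (j choose l)
       * (of_real (k\<^sup>2 * (2 * x)) * hankel_deriv 1 (k\<^sup>2 * (x\<^sup>2 + (y + real l * h)\<^sup>2))))) (at x)"
    unfolding Gshift_def by (intro has_vector_derivative_mult_right has_vector_derivative_sum) auto
  thus ?thesis
    by (simp add: Gshift_deriv_def shiftdiff_def hankel_monomial_def sum_distrib_left mult_ac)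
qed

lemma Gshift_has_vector_derivative_snd:
  assumes "Gshift_regular j h x y" "k > 0"
  shows "((\<lambda>t. Gshift j h k x t) has_vector_derivative Gshift_deriv 1 2 j h k x y) (at y)"
proof -
  have "((\<lambda>t. hankel01 (k * sqrt (x\<^sup>2 + (t + real l * h)\<^sup>2))) has_vector_derivative
     of_real (k\<^sup>2 * (2 * (y + real l * h))) * hankel_deriv 1 (k\<^sup>2 * (x\<^sup>2 + (y + real l * h)\<^sup>2))) (at y)" if "l \<le> j" for l
    by (rule hankel01_has_vector_derivative)
       (use assms that in \<open>auto simp: Gshift_regular_def intro!: derivative_eq_intros\<close>)
  hence "((\<lambda>t. Gshift j h k x t) has_vector_derivative (\<i> / 4) * (\<Sum>l\<le>j. (-1) ^ l * of_nat (j choose l)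
       * (of_real (k\<^sup>2 * (2 * (y + real l * h))) * hankel_deriv 1 (k\<^sup>2 * (x\<^sup>2 + (y + real l * h)\<^sup>2))))) (at y)"
    unfolding Gshift_def by (intro has_vector_derivative_mult_right has_vector_derivative_sum) auto
  also have "(\<Sum>l\<le>j. (-1) ^ l * of_nat (j choose l)
       * (of_real (k\<^sup>2 * (2 * (y + real l * h))) * hankel_deriv 1 (k\<^sup>2 * (x\<^sup>2 + (y + real l * h)\<^sup>2))))
      = 2 * shiftdiff j h (hankel_monomial k 1 1 x) y"
    unfolding shiftdiff_def sum_distrib_left
    by (intro sum.cong refl) (simp add: hankel_monomial_def mult_ac)
  finally show ?thesis by (simp add: Gshift_deriv_def)
qed

lemma dpart_Gshift:
  assumes "Gshift_regular j h x y" "k > 0" "l \<in> {0, 1}" "m \<in> {1, 2}"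
  shows "dpart l m (Gshift j h k) x y = Gshift_deriv l m j h k x y"
  using assms Gshift_eq[OF assms(1,2)]
    vector_derivative_at[OF Gshift_has_vector_derivative_fst[OF assms(1,2)]]
    vector_derivative_at[OF Gshift_has_vector_derivative_snd[OF assms(1,2)]]
  by (auto simp: dpart_def)

text \<open>With p the ceiling of j/2, the value admits exponent p. The x-derivative starts at b = 1
  and admits p + 1, one power of which pays for the factor x; the y-derivative starts at weight 2b -
  a = 1, which still admits p.\<close>

lemma Gshift_deriv_bound:
  assumes "h > 0" "K > 0" "c > 0" "M \<ge> 0" "j \<ge> 1"
  shows "\<exists>C\<ge>0. \<forall>k x y. 0 < k \<and> k \<le> K \<and> c \<le> \<bar>x\<bar> \<and> \<bar>y\<bar> \<le> M \<longrightarrow>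
     norm (Gshift_deriv l m j h k x y) \<le> C * \<bar>x\<bar> powr (- real ((j + 1) div 2) - 1/2)"
proof -
  define p where "p = (j + 1) div 2"
  have p: "2 * p \<le> j + 1" by (simp add: p_def)
  note bound = shiftdiff_hankel_monomial_bound[OF assms(1-3)]
  obtain C0 where C0: "C0 \<ge> 0" "\<And>k x y. 0 < k \<Longrightarrow> k \<le> K \<Longrightarrow> c \<le> \<bar>x\<bar> \<Longrightarrow> \<bar>y\<bar> \<le> M \<Longrightarrow>
     norm (shiftdiff j h (hankel_monomial k 0 0 x) y) \<le> C0 * \<bar>x\<bar> powr (- real p - 1/2)"
    using bound[of 0 0 j p M] p assms by auto
  obtain C1 where C1: "C1 \<ge> 0" "\<And>k x y. 0 < k \<Longrightarrow> k \<le> K \<Longrightarrow> c \<le> \<bar>x\<bar> \<Longrightarrow> \<bar>y\<bar> \<le> M \<Longrightarrow>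
     norm (shiftdiff j h (hankel_monomial k 0 1 x) y) \<le> C1 * \<bar>x\<bar> powr (- real (p + 1) - 1/2)"
    using bound[of 1 0 j "p + 1" M] p assms by auto
  obtain C2 where C2: "C2 \<ge> 0" "\<And>k x y. 0 < k \<Longrightarrow> k \<le> K \<Longrightarrow> c \<le> \<bar>x\<bar> \<Longrightarrow> \<bar>y\<bar> \<le> M \<Longrightarrow>
     norm (shiftdiff j h (hankel_monomial k 1 1 x) y) \<le> C2 * \<bar>x\<bar> powr (- real p - 1/2)"
    using bound[of 1 1 j p M] p assms by auto
  have "norm (Gshift_deriv l m j h k x y) \<le> (C0 + C1 + C2) * \<bar>x\<bar> powr (- real p - 1/2)"
    if k: "0 < k" "k \<le> K" and x: "c \<le> \<bar>x\<bar>" and y: "\<bar>y\<bar> \<le> M" for k x y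
  proof -
    define w where "w = \<bar>x\<bar> powr (- real p - 1/2)"
    have x0: "\<bar>x\<bar> > 0" using x \<open>c > 0\<close> by linarith
    have w: "w \<ge> 0" by (simp add: w_def)
    have "- real p - 1/2 = 1 + (- real (p + 1) - 1/2)" by simp
    hence xw: "\<bar>x\<bar> * \<bar>x\<bar> powr (- real (p + 1) - 1/2) = w"
      unfolding w_def using powr_add[of "\<bar>x\<bar>" 1 "- real (p + 1) - 1/2"] x0 by (simp add: algebra_simps)
    have "\<bar>x\<bar> * norm (shiftdiff j h (hankel_monomial k 0 1 x) y) \<le> C1 * w"
      using mult_left_mono[OF C1(2)[OF k x y], of "\<bar>x\<bar>"] unfolding xw[symmetric] by (simp add: mult_ac)
    moreover note C0(2)[OF k x y, folded w_def] C2(2)[OF k x y, folded w_def]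
    moreover have "C0 * w \<ge> 0" "C1 * w \<ge> 0" "C2 * w \<ge> 0" using C0 C1 C2 w by auto
    ultimately have "norm (Gshift_deriv l m j h k x y) \<le> C0 * w + C1 * w + C2 * w"
      by (auto simp: Gshift_deriv_def norm_mult)
    thus ?thesis by (simp add: w_def distrib_right)
  qed
  thus ?thesis using C0(1) C1(1) C2(1) unfolding p_def by (intro exI[of _ "C0 + C1 + C2"]) auto
qed

section \<open>The quasi-periodic series\<close>

text \<open>One step of the integral test: the mean value theorem for x^(1-q) on the unit interval
  to the left of x.\<close>

lemma powr_diff_bound:
  fixes q x :: real
  assumes "q > 1" "x > 1"
  shows "(q - 1) * x powr (- q) \<le> (x - 1) powr (1 - q) - x powr (1 - q)"
proof -
  have "\<exists>z. x - 1 < z \<and> z < x \<and> x powr (1 - q) - (x - 1) powr (1 - q) = (x - (x - 1)) * ((1 - q) * z powr (1 - q - 1))"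
    by (rule MVT2, simp, rule has_real_derivative_powr, use assms in linarith)
  then obtain z where z: "x - 1 < z" "z < x"
    "x powr (1 - q) - (x - 1) powr (1 - q) = (1 - q) * z powr (- q)" by auto
  have "x powr (- q) \<le> z powr (- q)"
    using z assms by (intro powr_mono2') auto
  hence "(q - 1) * x powr (- q) \<le> (q - 1) * z powr (- q)"
    using assms by (intro mult_left_mono) auto
  also have "\<dots> = (x - 1) powr (1 - q) - x powr (1 - q)"
    using z(3) by (simp add: algebra_simps)
  finally show ?thesis .
qed

text \<open>The preceding differences telescope. The base is N - 1 because each term is compared
  with the interval to its left.\<close>

lemma sum_powr_tail_bound:
  fixes q :: real and N :: nat
  assumes "q > 1" "N \<ge> 2"
  shows "(\<Sum>i=N..<N + r. real i powr (- q)) \<le> (real N - 1) powr (1 - q) / (q - 1)"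
proof -
  have "(q - 1) * (\<Sum>i=N..<N + r. real i powr (- q))
      \<le> (real N - 1) powr (1 - q) - (real (N + r) - 1) powr (1 - q)"
  proof (induction r)
    case (Suc r)
    have "(q - 1) * real (N + r) powr (- q)
        \<le> (real (N + r) - 1) powr (1 - q) - real (N + r) powr (1 - q)"
      using assms by (intro powr_diff_bound) auto
    thus ?case using Suc by (simp add: distrib_left)
  qed simp
  also have "\<dots> \<le> (real N - 1) powr (1 - q)" by simp
  finally show ?thesis using assms by (simp add: field_simps)
qed

text \<open>Nonnegative and negative indices are treated separately, since the absolute value is
  injective on each; this accounts for the factor 2. A bound on all finite partial sums yields both
  claims.\<close>

lemma int_powr_tail_bound:
  fixes q :: real and N :: int
  assumes q: "q > 1" and N: "N \<ge> 2"
  defines "B \<equiv> 2 * ((real_of_int N - 1) powr (1 - q) / (q - 1))"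
  shows "(\<lambda>n::int. \<bar>real_of_int n\<bar> powr (- q)) summable_on {n. \<bar>n\<bar> \<ge> N}" (is ?A)
    and "(\<Sum>\<^sub>\<infinity>n\<in>{n::int. \<bar>n\<bar> \<ge> N}. \<bar>real_of_int n\<bar> powr (- q)) \<le> B" (is ?B)
proof -
  have fin: "(\<Sum>n\<in>F. \<bar>real_of_int n\<bar> powr (- q)) \<le> B" if F: "finite F" "F \<subseteq> {n. \<bar>n\<bar> \<ge> N}" for F :: "int set"
  proof -
    have half: "(\<Sum>n\<in>G. \<bar>real_of_int n\<bar> powr (- q)) \<le> B / 2"
      if G: "finite G" "G \<subseteq> {n. \<bar>n\<bar> \<ge> N}" "inj_on (\<lambda>n. nat \<bar>n\<bar>) G" for G :: "int set"
    proof -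
      have "finite ((\<lambda>n. nat \<bar>n\<bar>) ` G)" using G by simp
      then obtain r where r: "\<And>i. i \<in> (\<lambda>n. nat \<bar>n\<bar>) ` G \<Longrightarrow> i < r"
        unfolding finite_nat_set_iff_bounded by blast
      have "(\<Sum>n\<in>G. \<bar>real_of_int n\<bar> powr (- q)) = (\<Sum>i\<in>(\<lambda>n. nat \<bar>n\<bar>) ` G. real i powr (- q))"
        by (subst sum.reindex[OF G(3)]) simp
      also have "\<dots> \<le> (\<Sum>i=nat N..<nat N + r. real i powr (- q))"
      proof (rule sum_mono2)
        show "(\<lambda>n. nat \<bar>n\<bar>) ` G \<subseteq> {nat N..<nat N + r}"
          using r G(2) by (fastforce simp: trans_less_add2)
      qed auto
      also have "\<dots> \<le> (real (nat N) - 1) powr (1 - q) / (q - 1)"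
        using q N by (intro sum_powr_tail_bound) auto
      also have "\<dots> = B / 2" using N by (simp only: B_def nonzero_mult_div_cancel_left zero_neq_numeral) simp
      finally show ?thesis .
    qed
    have "(\<Sum>n\<in>F. \<bar>real_of_int n\<bar> powr (- q))
        = (\<Sum>n\<in>F \<inter> {0..}. \<bar>real_of_int n\<bar> powr (- q)) + (\<Sum>n\<in>F - {0..}. \<bar>real_of_int n\<bar> powr (- q))"
      by (rule sum.Int_Diff[OF F(1)])
    also have "\<dots> \<le> B / 2 + B / 2"
      using F by (intro add_mono half) (auto simp: inj_on_def)
    finally show ?thesis by simp
  qed
  show ?A
    by (rule nonneg_bdd_above_summable_on) (use fin in \<open>auto simp: bdd_above_def\<close>)
  thus ?B by (rule infsum_le_finite_sums) (use fin in auto)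
qed

text \<open>Weierstrass test outside the finite set \<open>E\<close>. Indices in \<open>E\<close>
  need a derivative at \<open>t0\<close> only, which accommodates terms that are singular at other
  points of the ball.\<close>

lemma infsum_has_vector_derivative:
  fixes T T' :: "int \<Rightarrow> real \<Rightarrow> complex"
  assumes E: "finite E" and e: "e > 0"
    and deriv: "\<And>n t. n \<notin> E \<Longrightarrow> t \<in> ball t0 e \<Longrightarrow> (T n has_vector_derivative T' n t) (at t)"
    and bound: "\<And>n t. n \<notin> E \<Longrightarrow> t \<in> ball t0 e \<Longrightarrow> norm (T n t) \<le> B n"
    and bound': "\<And>n t. n \<notin> E \<Longrightarrow> t \<in> ball t0 e \<Longrightarrow> norm (T' n t) \<le> B n"
    and B: "B summable_on - E"
    and exc: "\<And>n. n \<in> E \<Longrightarrow> (T n has_vector_derivative T' n t0) (at t0)"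
  shows "((\<lambda>t. \<Sum>\<^sub>\<infinity>n. T n t) has_vector_derivative (\<Sum>\<^sub>\<infinity>n. T' n t0)) (at t0)"
    and "(\<lambda>n. T' n t0) summable_on UNIV"
proof -
  have U: "E \<union> - E = UNIV" "E \<inter> - E = {}" by auto
  have t0: "t0 \<in> ball t0 e" using e by simp
  have sT: "(\<lambda>n. T n t) summable_on - E" if "t \<in> ball t0 e" for t
    by (rule abs_summable_summable, rule Infinite_Sum.abs_summable_on_comparison_test'[OF B]) (use bound that in auto)
  have sT': "(\<lambda>n. T' n t) summable_on - E" if "t \<in> ball t0 e" for t
    by (rule abs_summable_summable, rule Infinite_Sum.abs_summable_on_comparison_test'[OF B]) (use bound' that in auto)
  show "(\<lambda>n. T' n t0) summable_on UNIV"
    using summable_on_Un_disjoint[OF summable_on_finite[OF E] sT'[OF t0] U(2)] U(1) by simp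
  have "infinite (- E)" using E by (simp add: finite_compl infinite_UNIV_int)
  \<comment> \<open>The theorem on differentiating series is about sequences, so the complement of
    \<open>E\<close> is enumerated; unconditional summability makes the choice of enumeration
    immaterial.\<close>
  then obtain b :: "nat \<Rightarrow> int" where b: "bij_betw b UNIV (- E)"
    using bij_betw_from_nat_into[of "- E"] by (auto intro: countableI_type)
  hence bE: "b i \<notin> E" for i by (auto simp: bij_betw_def)
  have "(\<lambda>i. B (b i)) summable_on UNIV"
    using B summable_on_reindex_bij_betw[OF b, of B] by simp
  hence Bs: "summable (\<lambda>i. B (b i))" by (rule summable_on_imp_summable)
  have sums: "(\<lambda>i. F (b i)) sums infsum F (- E)" if "F summable_on - E" for F :: "int \<Rightarrow> complex"
    using that has_sum_imp_sums[OF has_sum_infsum, of "\<lambda>i. F (b i)"]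
    by (simp add: infsum_reindex_bij_betw[OF b] summable_on_reindex_bij_betw[OF b])
  define S' where "S' t = (\<Sum>i. T' (b i) t)" for t
  have S': "S' t = infsum (\<lambda>n. T' n t) (- E)" if "t \<in> ball t0 e" for t
    unfolding S'_def using sums[OF sT'[OF that]] by (rule sums_unique[symmetric])
  have unif: "uniform_limit (ball t0 e) (\<lambda>n t. \<Sum>i<n. T' (b i) t) S' sequentially"
    unfolding S'_def by (rule Weierstrass_m_test[OF _ Bs]) (use bound' bE in auto)
  have "\<exists>g. \<forall>t\<in>ball t0 e. (\<lambda>i. T (b i) t) sums g t
      \<and> (g has_derivative (\<lambda>x. x *\<^sub>R S' t)) (at t within ball t0 e)"
  proof (rule has_derivative_series[where f' = "\<lambda>i t x. x *\<^sub>R T' (b i) t" and x = t0])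
    show "(T (b i) has_derivative (\<lambda>x. x *\<^sub>R T' (b i) t)) (at t within ball t0 e)"
      if "t \<in> ball t0 e" for i t
      using deriv[OF bE that] unfolding has_vector_derivative_def by (rule has_derivative_at_withinI)
    show "(\<lambda>i. T (b i) t0) sums infsum (\<lambda>n. T n t0) (- E)" by (rule sums[OF sT[OF t0]])
    fix \<epsilon> :: real assume "\<epsilon> > 0"
    hence "\<forall>\<^sub>F n in sequentially. \<forall>t\<in>ball t0 e. dist (\<Sum>i<n. T' (b i) t) (S' t) < \<epsilon>"
      using unif unfolding uniform_limit_iff by blast
    thus "\<forall>\<^sub>F n in sequentially. \<forall>t\<in>ball t0 e. \<forall>x.
        norm ((\<Sum>i<n. x *\<^sub>R T' (b i) t) - x *\<^sub>R S' t) \<le> \<epsilon> * norm x"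
    proof eventually_elim
      case (elim n)
      show ?case
      proof (intro ballI allI)
        fix t x assume "t \<in> ball t0 e"
        hence "norm ((\<Sum>i<n. T' (b i) t) - S' t) \<le> \<epsilon>" using elim by (force simp: dist_norm)
        from mult_left_mono[OF this, of "\<bar>x\<bar>"]
        show "norm ((\<Sum>i<n. x *\<^sub>R T' (b i) t) - x *\<^sub>R S' t) \<le> \<epsilon> * norm x"
          by (simp add: scaleR_sum_right[symmetric] scaleR_diff_right[symmetric] mult.commute)
      qed
    qed
  qed (use t0 in auto)
  then obtain g where g: "\<And>t. t \<in> ball t0 e \<Longrightarrow> (\<lambda>i. T (b i) t) sums g t"
    "\<And>t. t \<in> ball t0 e \<Longrightarrow> (g has_derivative (\<lambda>x. x *\<^sub>R S' t)) (at t within ball t0 e)" by blast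
  have "(g has_vector_derivative S' t0) (at t0)"
    using g(2)[OF t0] at_within_open[OF t0] unfolding has_vector_derivative_def by simp
  hence "((\<lambda>t. (\<Sum>n\<in>E. T n t) + g t) has_vector_derivative (\<Sum>n\<in>E. T' n t0) + S' t0) (at t0)"
    by (intro has_vector_derivative_add has_vector_derivative_sum exc)
  moreover have "(\<Sum>n\<in>E. T n t) + g t = (\<Sum>\<^sub>\<infinity>n. T n t)" if t: "t \<in> ball t0 e" for t
    using infsum_Un_disjoint[OF summable_on_finite[OF E] sT[OF t] U(2)] U(1)
      sums_unique2[OF g(1)[OF t] sums[OF sT[OF t]]] E by simp
  ultimately have "((\<lambda>t. \<Sum>\<^sub>\<infinity>n. T n t) has_vector_derivative (\<Sum>n\<in>E. T' n t0) + S' t0) (at t0)"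
    using t0 by (elim has_vector_derivative_transform_within_open[where S = "ball t0 e"]) auto
  also have "(\<Sum>n\<in>E. T' n t0) + S' t0 = (\<Sum>\<^sub>\<infinity>n. T' n t0)"
    using infsum_Un_disjoint[OF summable_on_finite[OF E] sT'[OF t0] U(2)] U(1) S'[OF t0] E by simp
  finally show "((\<lambda>t. \<Sum>\<^sub>\<infinity>n. T n t) has_vector_derivative (\<Sum>\<^sub>\<infinity>n. T' n t0)) (at t0)" .
qed

text \<open>Every finite set of integers lies in all sufficiently large symmetric intervals, so
  these run through the filter that defines the infinite sum.\<close>

lemma symmetric_partial_sums_tendsto_infsum:
  fixes f :: "int \<Rightarrow> complex"
  assumes "f summable_on UNIV"
  shows "(\<lambda>N::nat. \<Sum>n\<in>{- int N..int N}. f n) \<longlonglongrightarrow> infsum f UNIV"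
proof -
  have "filterlim (\<lambda>N::nat. {- int N..int N}) (finite_subsets_at_top UNIV) sequentially"
    unfolding filterlim_finite_subsets_at_top
  proof (intro allI impI)
    fix F :: "int set" assume "finite F \<and> F \<subseteq> UNIV"
    then have "finite (abs ` F)" by simp
    then obtain M where M: "\<forall>n\<in>abs ` F. n \<le> M" by (meson bdd_above_finite bdd_above_def)
    show "\<forall>\<^sub>F N in sequentially. finite {- int N..int N} \<and> F \<subseteq> {- int N..int N} \<and> {- int N..int N} \<subseteq> UNIV"
      using eventually_ge_at_top[of "nat M"] by eventually_elim (use M in force)
  qed
  with has_sum_infsum[OF assms] show ?thesis
    unfolding has_sum_def by (rule filterlim_compose)
qed

section \<open>Tail estimate for the quasi-periodic series\<close>

lemma norm_qterm: "norm (qterm L \<theta> k F x y n) = norm (F (x + real_of_int n * L) y)"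
  by (simp add: qterm_def norm_mult)

text \<open>This is where j \<ge> 1 gives absolute convergence: the exponent is at least
  3/2.\<close>

lemma decay_exponent_gt_1: "j \<ge> 1 \<Longrightarrow> real ((j + 1) div 2) + 1/2 > 1"
proof -
  assume "j \<ge> 1"
  hence "(j + 1) div 2 \<ge> 1" by simp
  hence "real ((j + 1) div 2) \<ge> 1" by linarith
  thus ?thesis by simp
qed

text \<open>For |n| \<ge> 2 and |x| \<le> L, the shifted abscissa x + nL has modulus at least L and
  at least |n| L/2. All tail terms are thus away from the singularities and comparable with a power
  of |n|.\<close>

lemma qterm_tail_bound:
  fixes h L K M :: real
  assumes L: "L > 0" and j: "j \<ge> 1" and "h > 0" "l \<in> {0, 1}" "m \<in> {1, 2}" "K > 0" "M \<ge> 0"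
  shows "\<exists>D>0. \<forall>x y k. \<forall>N::int. \<bar>x\<bar> \<le> L \<and> \<bar>y\<bar> \<le> M \<and> 0 < k \<and> k \<le> K \<and> N > 1 \<longrightarrow>
      (\<lambda>n. qterm L \<theta> k (dpart l m (Gshift j h k)) x y n) summable_on {n. \<bar>n\<bar> \<ge> N}
    \<and> norm (\<Sum>\<^sub>\<infinity>n\<in>{n. \<bar>n\<bar> \<ge> N}. qterm L \<theta> k (dpart l m (Gshift j h k)) x y n)
        \<le> D * real_of_int N powr (1/2 - real ((j + 1) div 2))"
proof -
  define q where "q = real ((j + 1) div 2) + 1/2"
  have q: "q > 1" unfolding q_def by (rule decay_exponent_gt_1[OF j])
  have eq: "- real ((j + 1) div 2) - 1/2 = - q" by (simp add: q_def)
  obtain C where C: "C \<ge> 0" "\<And>k x y. 0 < k \<Longrightarrow> k \<le> K \<Longrightarrow> L \<le> \<bar>x\<bar> \<Longrightarrow> \<bar>y\<bar> \<le> M \<Longrightarrow>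
     norm (Gshift_deriv l m j h k x y) \<le> C * \<bar>x\<bar> powr (- q)"
    using Gshift_deriv_bound[of h K L M j l m] assms unfolding eq by blast
  define A where "A = C * (L / 2) powr (- q)"
  have A: "A \<ge> 0" using C(1) by (simp add: A_def)
  \<comment> \<open>The power of 2 comes from N - 1 \<ge> N/2; the added 1 makes \<open>D\<close>
    positive even if \<open>A\<close> is 0.\<close>
  define D where "D = A * (2 / (q - 1) * 2 powr (q - 1)) + 1"
  have D: "D > 0" using A q by (simp add: D_def add_nonneg_pos)
  have main: "(\<lambda>n. qterm L \<theta> k (dpart l m (Gshift j h k)) x y n) summable_on {n. \<bar>n\<bar> \<ge> N}
    \<and> norm (\<Sum>\<^sub>\<infinity>n\<in>{n. \<bar>n\<bar> \<ge> N}. qterm L \<theta> k (dpart l m (Gshift j h k)) x y n)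
        \<le> D * real_of_int N powr (1 - q)"
    if x: "\<bar>x\<bar> \<le> L" and y: "\<bar>y\<bar> \<le> M" and k: "0 < k" "k \<le> K" and N: "N > 1" for x y k and N :: int
  proof -
    define f where "f = qterm L \<theta> k (dpart l m (Gshift j h k)) x y"
    have N2: "N \<ge> 2" using N by simp
    note tail = int_powr_tail_bound[OF q N2]
    have fbound: "norm (f n) \<le> A * \<bar>real_of_int n\<bar> powr (- q)" if n: "\<bar>n\<bar> \<ge> N" for n
    proof -
      have n2: "\<bar>real_of_int n\<bar> \<ge> 2" using n N2 by linarith
      have "\<bar>real_of_int n\<bar> * L - L \<le> \<bar>x + real_of_int n * L\<bar>"
        using x abs_triangle_ineq2[of "real_of_int n * L" "- x"] L by (simp add: abs_mult add.commute)
      moreover have "2 * L \<le> \<bar>real_of_int n\<bar> * L" using n2 L by (intro mult_right_mono) auto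
      ultimately have z: "L / 2 * \<bar>real_of_int n\<bar> \<le> \<bar>x + real_of_int n * L\<bar>" "L \<le> \<bar>x + real_of_int n * L\<bar>"
        by (simp_all add: mult.commute)
      have "x + real_of_int n * L \<noteq> 0" using z(2) L by auto
      hence "Gshift_regular j h (x + real_of_int n * L) y"
        by (simp add: Gshift_regular_def add_pos_nonneg)
      hence "norm (f n) = norm (Gshift_deriv l m j h k (x + real_of_int n * L) y)"
        unfolding f_def norm_qterm using assms k by (simp add: dpart_Gshift)
      also have "\<dots> \<le> C * \<bar>x + real_of_int n * L\<bar> powr (- q)"
        by (rule C(2)[OF k z(2) y])
      also have "\<dots> \<le> C * (L / 2 * \<bar>real_of_int n\<bar>) powr (- q)"
        using z(1) C(1) L n2 q by (intro mult_left_mono powr_mono2') auto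
      also have "\<dots> = A * \<bar>real_of_int n\<bar> powr (- q)"
        by (subst powr_mult) (use L in \<open>auto simp: A_def\<close>)
      finally show ?thesis .
    qed
    have sA: "(\<lambda>n::int. A * \<bar>real_of_int n\<bar> powr (- q)) summable_on {n. \<bar>n\<bar> \<ge> N}"
      by (rule summable_on_cmult_right[OF tail(1)])
    have s: "f summable_on {n. \<bar>n\<bar> \<ge> N}"
      by (rule abs_summable_summable, rule Infinite_Sum.abs_summable_on_comparison_test'[OF sA]) (use fbound in auto)
    have "norm (infsum f {n. \<bar>n\<bar> \<ge> N}) \<le> (\<Sum>\<^sub>\<infinity>n\<in>{n. \<bar>n\<bar> \<ge> N}. A * \<bar>real_of_int n\<bar> powr (- q))"
      by (rule norm_infsum_le[OF has_sum_infsum[OF s] has_sum_infsum[OF sA]]) (use fbound in auto)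
    also have "\<dots> = A * (\<Sum>\<^sub>\<infinity>n\<in>{n::int. \<bar>n\<bar> \<ge> N}. \<bar>real_of_int n\<bar> powr (- q))"
      by (rule infsum_cmult_right')
    also have "\<dots> \<le> A * (2 * ((real_of_int N - 1) powr (1 - q) / (q - 1)))"
      by (intro mult_left_mono tail(2) A)
    also have "\<dots> \<le> A * (2 * ((real_of_int N / 2) powr (1 - q) / (q - 1)))"
    proof -
      have "(real_of_int N - 1) powr (1 - q) \<le> (real_of_int N / 2) powr (1 - q)"
        using N2 q by (intro powr_mono2') auto
      thus ?thesis using A q by (intro mult_left_mono divide_right_mono) auto
    qed
    also have "(real_of_int N / 2) powr (1 - q) = 2 powr (q - 1) * real_of_int N powr (1 - q)"
      using N2 powr_minus_divide[of 2 "q - 1"] by (simp add: powr_divide)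
    also have "A * (2 * (2 powr (q - 1) * real_of_int N powr (1 - q) / (q - 1)))
        = A * (2 / (q - 1) * 2 powr (q - 1)) * real_of_int N powr (1 - q)"
      by simp
    also have "\<dots> \<le> D * real_of_int N powr (1 - q)"
      unfolding D_def by (intro mult_right_mono) auto
    finally show ?thesis using s by (simp add: f_def)
  qed
  moreover have "1 - q = 1/2 - real ((j + 1) div 2)" by (simp add: q_def)
  ultimately show ?thesis using D by auto
qed

text \<open>Since \<open>(j + 1) div 2\<close> is the ceiling of j/2, the two parity cases of the
  rate are one formula.\<close>

lemma half_ceiling_exponent:
  "1/2 - real ((j + 1) div 2) = (if even j then - (real j - 1) / 2 else - real j / 2)"
proof (cases "even j")
  case True
  then obtain i where "j = 2 * i" by (elim evenE)
  thus ?thesis by simp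
next
  case False
  then obtain i where "j = 2 * i + 1" by (elim oddE)
  thus ?thesis by (simp add: field_simps)
qed

section \<open>Termwise differentiation at a nonsingular point\<close>

context
  fixes L \<theta> h k X Y :: real and j :: nat
  assumes L: "L > 0" and h: "h > 0" and k: "k > 0" and j: "j \<ge> 1" and X: "\<bar>X\<bar> \<le> L"
    and nonsing: "\<forall>n::int. \<forall>l'\<le>j. (X + real_of_int n * L, Y) \<noteq> (0, - real l' * h)"
begin

text \<open>The window in x and y contains the ball of radius L about \<open>X\<close> and the ball
  of radius 1 about \<open>Y\<close>. On it |x| may reach 2L, so |n| \<ge> 3 is what keeps |x + nL|
  at least L, whence the five exceptional indices.\<close>

definition majorant :: "nat \<Rightarrow> nat \<Rightarrow> (int \<Rightarrow> real) \<Rightarrow> bool" where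
  "majorant l m B \<longleftrightarrow> B summable_on - {-2..2} \<and>
     (\<forall>n x y. n \<notin> {-2..2} \<longrightarrow> \<bar>x\<bar> \<le> 2 * L \<longrightarrow> \<bar>y\<bar> \<le> \<bar>Y\<bar> + 1 \<longrightarrow>
        norm (Gshift_deriv l m j h k (x + real_of_int n * L) y) \<le> B n)"

lemma shifted_abscissa_bounds:
  assumes "n \<notin> {-2..2}" "\<bar>x\<bar> \<le> 2 * L"
  shows "L / 3 * \<bar>real_of_int n\<bar> \<le> \<bar>x + real_of_int n * L\<bar>" "L \<le> \<bar>x + real_of_int n * L\<bar>"
proof -
  have n: "\<bar>n\<bar> \<ge> 3" using assms by auto
  hence n3: "\<bar>real_of_int n\<bar> \<ge> 3" by linarith
  have "\<bar>real_of_int n\<bar> * L - 2 * L \<le> \<bar>x + real_of_int n * L\<bar>"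
    using assms(2) abs_triangle_ineq2[of "real_of_int n * L" "- x"] L by (simp add: abs_mult add.commute)
  moreover have "3 * L \<le> \<bar>real_of_int n\<bar> * L" using n3 L by (intro mult_right_mono) auto
  ultimately show "L / 3 * \<bar>real_of_int n\<bar> \<le> \<bar>x + real_of_int n * L\<bar>" "L \<le> \<bar>x + real_of_int n * L\<bar>"
    by (simp_all add: mult.commute)
qed

lemma regular_far:
  assumes "n \<notin> {-2..2}" "\<bar>x\<bar> \<le> 2 * L"
  shows "Gshift_regular j h (x + real_of_int n * L) y"
proof -
  have "x + real_of_int n * L \<noteq> 0" using shifted_abscissa_bounds(2)[OF assms] L by auto
  thus ?thesis by (simp add: Gshift_regular_def add_pos_nonneg)
qed

lemma regular_at: "Gshift_regular j h (X + real_of_int n * L) Y"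
  unfolding Gshift_regular_def
proof (intro allI impI)
  fix l' assume "l' \<le> j"
  hence "X + real_of_int n * L \<noteq> 0 \<or> Y + real l' * h \<noteq> 0" using nonsing by fastforce
  thus "(X + real_of_int n * L)\<^sup>2 + (Y + real l' * h)\<^sup>2 > 0"
    by (simp add: sum_power2_gt_zero_iff)
qed

lemma majorant_exists: "\<exists>B. majorant l m B"
proof -
  define q where "q = real ((j + 1) div 2) + 1/2"
  have q: "q > 1" unfolding q_def by (rule decay_exponent_gt_1[OF j])
  have eq: "- real ((j + 1) div 2) - 1/2 = - q" by (simp add: q_def)
  obtain C where C: "C \<ge> 0" "\<And>x y. L \<le> \<bar>x\<bar> \<Longrightarrow> \<bar>y\<bar> \<le> \<bar>Y\<bar> + 1 \<Longrightarrow>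
     norm (Gshift_deriv l m j h k x y) \<le> C * \<bar>x\<bar> powr (- q)"
    using Gshift_deriv_bound[of h k L "\<bar>Y\<bar> + 1" j l m] L h k j unfolding eq by auto
  define B where "B n = C * (L / 3) powr (- q) * \<bar>real_of_int n\<bar> powr (- q)" for n :: int
  have "- {-2..2} = {n::int. \<bar>n\<bar> \<ge> 3}" by auto
  hence "B summable_on - {-2..2}"
    using int_powr_tail_bound(1)[OF q, of 3] unfolding B_def by (auto intro: summable_on_cmult_right)
  moreover have "norm (Gshift_deriv l m j h k (x + real_of_int n * L) y) \<le> B n"
    if n: "n \<notin> {-2..2}" and x: "\<bar>x\<bar> \<le> 2 * L" and y: "\<bar>y\<bar> \<le> \<bar>Y\<bar> + 1" for n x y
  proof -
    note z = shifted_abscissa_bounds[OF n x]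
    have n0: "\<bar>real_of_int n\<bar> > 0" using n by auto
    have "norm (Gshift_deriv l m j h k (x + real_of_int n * L) y) \<le> C * \<bar>x + real_of_int n * L\<bar> powr (- q)"
      by (rule C(2)[OF z(2) y])
    also have "\<dots> \<le> C * (L / 3 * \<bar>real_of_int n\<bar>) powr (- q)"
      using z(1) C(1) L n0 q by (intro mult_left_mono powr_mono2') auto
    also have "\<dots> = B n" by (subst powr_mult) (use L in \<open>auto simp: B_def\<close>)
    finally show ?thesis .
  qed
  ultimately show ?thesis unfolding majorant_def by blast
qed

lemma common_majorant:
  obtains B where "majorant 0 m B" "majorant 1 m B"
proof -
  obtain B0 B1 where B: "majorant 0 m B0" "majorant 1 m B1" using majorant_exists by blast
  show ?thesis
  \<comment> \<open>A \<open>majorant\<close> may be negative at the exceptional indices; absolute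
    values make the sum dominate both functions everywhere.\<close>
  proof (rule that[of "\<lambda>n. \<bar>B0 n\<bar> + \<bar>B1 n\<bar>"])
    have "(\<lambda>n. \<bar>B0 n\<bar>) summable_on - {-2..2}" "(\<lambda>n. \<bar>B1 n\<bar>) summable_on - {-2..2}"
      using B summable_on_iff_abs_summable_on_real[of B0] summable_on_iff_abs_summable_on_real[of B1]
      unfolding majorant_def by auto
    hence "(\<lambda>n. \<bar>B0 n\<bar> + \<bar>B1 n\<bar>) summable_on - {-2..2}" by (rule summable_on_add)
    moreover have "B0 n \<le> \<bar>B0 n\<bar> + \<bar>B1 n\<bar>" "B1 n \<le> \<bar>B0 n\<bar> + \<bar>B1 n\<bar>" for n by simp_all
    ultimately show "majorant 0 m (\<lambda>n. \<bar>B0 n\<bar> + \<bar>B1 n\<bar>)" "majorant 1 m (\<lambda>n. \<bar>B0 n\<bar> + \<bar>B1 n\<bar>)"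
      using B unfolding majorant_def by (meson order_trans)+
  qed
qed

text \<open>The value agrees by the definition of \<open>Gq\<close>; the content is summability,
  from the majorant for the far terms and finiteness for the rest.\<close>

lemma Gq_value:
  "(\<lambda>n. qterm L \<theta> k (dpart 0 m (Gshift j h k)) X Y n) summable_on UNIV"
  "(\<Sum>\<^sub>\<infinity>n. qterm L \<theta> k (dpart 0 m (Gshift j h k)) X Y n) = dpart 0 m (Gq L \<theta> j h k) X Y"
proof -
  obtain B where B: "majorant 0 m B" using majorant_exists by blast
  have X2: "\<bar>X\<bar> \<le> 2 * L" using X L by simp
  define f where "f n = qterm L \<theta> k (dpart 0 m (Gshift j h k)) X Y n" for n
  have fB: "norm (f n) \<le> B n" if "n \<in> - {-2..2}" for n
  proof -
    have "norm (f n) = norm (Gshift_deriv 0 m j h k (X + real_of_int n * L) Y)"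
      unfolding f_def norm_qterm using Gshift_eq[OF regular_at k] by (simp add: dpart_def)
    also have "\<dots> \<le> B n" using B that X2 unfolding majorant_def by auto
    finally show ?thesis .
  qed
  have "B summable_on - {-2..2}" using B unfolding majorant_def by blast
  from abs_summable_summable[OF Infinite_Sum.abs_summable_on_comparison_test'[OF this fB]]
  have "f summable_on - {-2..2}" .
  moreover have "f summable_on {-2..2}" by (rule summable_on_finite) simp
  ultimately have "f summable_on (- {-2..2} \<union> {-2..2})" by (rule summable_on_Un_disjoint) blast
  moreover have "- {-2..2} \<union> {-2..2} = (UNIV :: int set)" by blast
  ultimately show "(\<lambda>n. qterm L \<theta> k (dpart 0 m (Gshift j h k)) X Y n) summable_on UNIV"
    unfolding f_def[abs_def] by (simp only:)
  show "(\<Sum>\<^sub>\<infinity>n. qterm L \<theta> k (dpart 0 m (Gshift j h k)) X Y n) = dpart 0 m (Gq L \<theta> j h k) X Y"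
  proof -
    have "dpart 0 m (Gshift j h k) = Gshift j h k" by (intro ext) (simp add: dpart_def)
    thus ?thesis by (simp add: dpart_def Gq_def)
  qed
qed

text \<open>Terms with |n| \<ge> 3 are regular and dominated on the whole ball of radius L about
  \<open>X\<close>. The five others are differentiable at \<open>X\<close> because the point avoids
  all singularities.\<close>

lemma Gq_has_vector_derivative_fst:
  "((\<lambda>t. Gq L \<theta> j h k t Y) has_vector_derivative
      (\<Sum>\<^sub>\<infinity>n. qterm L \<theta> k (Gshift_deriv 1 1 j h k) X Y n)) (at X)"
  "(\<lambda>n. qterm L \<theta> k (Gshift_deriv 1 1 j h k) X Y n) summable_on UNIV"
proof -
  obtain B where B: "majorant 0 1 B" "majorant 1 1 B" using common_majorant .
  have x: "\<bar>t\<bar> \<le> 2 * L" if "t \<in> ball X L" for t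
    using that X by (auto simp: dist_real_def)
  have d: "((\<lambda>t. qterm L \<theta> k (Gshift j h k) t Y n) has_vector_derivative
      qterm L \<theta> k (Gshift_deriv 1 1 j h k) t Y n) (at t)"
    if "Gshift_regular j h (t + real_of_int n * L) Y" for t n
  proof -
    have "((\<lambda>t. t + real_of_int n * L) has_vector_derivative 1) (at t)"
      by (auto intro!: derivative_eq_intros)
    from vector_diff_chain_at[OF this Gshift_has_vector_derivative_fst[OF that k]]
    show ?thesis unfolding qterm_def by (intro has_vector_derivative_mult_right) (simp add: o_def)
  qed
  note * = infsum_has_vector_derivative[where E = "{-2..2}" and e = L and ?t0.0 = X and B = B
      and T = "\<lambda>n t. qterm L \<theta> k (Gshift j h k) t Y n"
      and T' = "\<lambda>n t. qterm L \<theta> k (Gshift_deriv 1 1 j h k) t Y n", OF _ L]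
  have 1: "norm (qterm L \<theta> k (Gshift j h k) t Y n) \<le> B n"
    and 2: "norm (qterm L \<theta> k (Gshift_deriv 1 1 j h k) t Y n) \<le> B n"
    if "n \<notin> {-2..2}" "t \<in> ball X L" for n t
    using B that(1) x[OF that(2)] k regular_far[OF that(1) x[OF that(2)], of Y]
    unfolding majorant_def norm_qterm by (simp_all add: Gshift_eq[where m = 1])
  have S: "B summable_on - {-2..2}" using B unfolding majorant_def by blast
  have 3: "((\<lambda>t. \<Sum>\<^sub>\<infinity>n. qterm L \<theta> k (Gshift j h k) t Y n) has_vector_derivative
      (\<Sum>\<^sub>\<infinity>n. qterm L \<theta> k (Gshift_deriv 1 1 j h k) X Y n)) (at X)"
    by (rule *(1)) (use d 1 2 S regular_at regular_far x in auto)
  show "((\<lambda>t. Gq L \<theta> j h k t Y) has_vector_derivative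
      (\<Sum>\<^sub>\<infinity>n. qterm L \<theta> k (Gshift_deriv 1 1 j h k) X Y n)) (at X)"
    unfolding Gq_def using 3 by simp
  show "(\<lambda>n. qterm L \<theta> k (Gshift_deriv 1 1 j h k) X Y n) summable_on UNIV"
    by (rule *(2)) (use d 1 2 S regular_at regular_far x in auto)
qed

lemma Gq_has_vector_derivative_snd:
  "((\<lambda>t. Gq L \<theta> j h k X t) has_vector_derivative
      (\<Sum>\<^sub>\<infinity>n. qterm L \<theta> k (Gshift_deriv 1 2 j h k) X Y n)) (at Y)"
  "(\<lambda>n. qterm L \<theta> k (Gshift_deriv 1 2 j h k) X Y n) summable_on UNIV"
proof -
  obtain B where B: "majorant 0 2 B" "majorant 1 2 B" using common_majorant .
  have x: "\<bar>X\<bar> \<le> 2 * L" using X L by simp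
  have y: "\<bar>t\<bar> \<le> \<bar>Y\<bar> + 1" if "t \<in> ball Y 1" for t
    using that by (auto simp: dist_real_def)
  have d: "((\<lambda>t. qterm L \<theta> k (Gshift j h k) X t n) has_vector_derivative
      qterm L \<theta> k (Gshift_deriv 1 2 j h k) X t n) (at t)"
    if "Gshift_regular j h (X + real_of_int n * L) t" for t n
    unfolding qterm_def by (intro has_vector_derivative_mult_right Gshift_has_vector_derivative_snd that k)
  note * = infsum_has_vector_derivative[where E = "{-2..2}" and e = 1 and ?t0.0 = Y and B = B
      and T = "\<lambda>n t. qterm L \<theta> k (Gshift j h k) X t n"
      and T' = "\<lambda>n t. qterm L \<theta> k (Gshift_deriv 1 2 j h k) X t n"]
  have 1: "norm (qterm L \<theta> k (Gshift j h k) X t n) \<le> B n"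
    and 2: "norm (qterm L \<theta> k (Gshift_deriv 1 2 j h k) X t n) \<le> B n"
    if "n \<notin> {-2..2}" "t \<in> ball Y 1" for n t
    using B that(1) x y[OF that(2)] k regular_far[OF that(1) x, of t]
    unfolding majorant_def norm_qterm by (simp_all add: Gshift_eq[where m = 2])
  have S: "B summable_on - {-2..2}" using B unfolding majorant_def by blast
  have 3: "((\<lambda>t. \<Sum>\<^sub>\<infinity>n. qterm L \<theta> k (Gshift j h k) X t n) has_vector_derivative
      (\<Sum>\<^sub>\<infinity>n. qterm L \<theta> k (Gshift_deriv 1 2 j h k) X Y n)) (at Y)"
    by (rule *(1)) (use d 1 2 S regular_at regular_far[OF _ x] in auto)
  show "((\<lambda>t. Gq L \<theta> j h k X t) has_vector_derivative
      (\<Sum>\<^sub>\<infinity>n. qterm L \<theta> k (Gshift_deriv 1 2 j h k) X Y n)) (at Y)"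
    unfolding Gq_def using 3 by simp
  show "(\<lambda>n. qterm L \<theta> k (Gshift_deriv 1 2 j h k) X Y n) summable_on UNIV"
    by (rule *(2)) (use d 1 2 S regular_at regular_far[OF _ x] in auto)
qed

lemma dpart_Gq:
  assumes "l \<in> {0, 1}" "m \<in> {1, 2}"
  shows "dpart_exists l m (Gq L \<theta> j h k) X Y"
    and "(\<lambda>n. qterm L \<theta> k (dpart l m (Gshift j h k)) X Y n) summable_on UNIV"
    and "(\<Sum>\<^sub>\<infinity>n. qterm L \<theta> k (dpart l m (Gshift j h k)) X Y n) = dpart l m (Gq L \<theta> j h k) X Y"
proof -
  have q: "qterm L \<theta> k (dpart l m (Gshift j h k)) X Y n = qterm L \<theta> k (Gshift_deriv l m j h k) X Y n" for n
    unfolding qterm_def using dpart_Gshift[OF regular_at k assms] by simp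
  note d = Gq_has_vector_derivative_fst Gq_has_vector_derivative_snd
  consider "l = 0" | "l = 1" "m = 1" | "l = 1" "m = 2" using assms by auto
  hence "dpart_exists l m (Gq L \<theta> j h k) X Y
    \<and> (\<lambda>n. qterm L \<theta> k (dpart l m (Gshift j h k)) X Y n) summable_on UNIV
    \<and> (\<Sum>\<^sub>\<infinity>n. qterm L \<theta> k (dpart l m (Gshift j h k)) X Y n) = dpart l m (Gq L \<theta> j h k) X Y"
  proof cases
    case 1
    thus ?thesis using Gq_value by (simp add: dpart_exists_def)
  next
    case 2
    thus ?thesis unfolding q using d(1,2) vector_derivative_at[OF d(1)]
      by (auto simp: dpart_exists_def dpart_def intro: differentiableI_vector)
  next
    case 3
    thus ?thesis unfolding q using d(3,4) vector_derivative_at[OF d(3)]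
      by (auto simp: dpart_exists_def dpart_def intro: differentiableI_vector)
  qed
  thus "dpart_exists l m (Gq L \<theta> j h k) X Y"
    "(\<lambda>n. qterm L \<theta> k (dpart l m (Gshift j h k)) X Y n) summable_on UNIV"
    "(\<Sum>\<^sub>\<infinity>n. qterm L \<theta> k (dpart l m (Gshift j h k)) X Y n) = dpart l m (Gq L \<theta> j h k) X Y" by auto
qed

end

theorem mainTheorem1:
  fixes L \<theta> h k0 :: real and j l m :: nat
  assumes "L > 0" and "-(pi/2) < \<theta>" and "\<theta> < pi/2"
    and "j \<ge> 1" and "h > 0" and "l \<in> {0, 1}" and "m \<in> {1, 2}" and "k0 > 0"
  shows "(\<forall>M>0. \<forall>\<delta>>0. \<exists>D>0. \<forall>X Y k. \<forall>N::int.
      -L \<le> X \<and> X \<le> L \<and> -M < Y \<and> Y < M \<and> k > 0 \<and> \<bar>k - k0\<bar> < \<delta> \<and> N > 1 \<longrightarrow>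
        (\<lambda>n. qterm L \<theta> k (dpart l m (Gshift j h k)) X Y n) summable_on {n. \<bar>n\<bar> \<ge> N}
      \<and> norm (\<Sum>\<^sub>\<infinity>n\<in>{n. \<bar>n\<bar> \<ge> N}. qterm L \<theta> k (dpart l m (Gshift j h k)) X Y n)
          \<le> D * (if even j then real_of_int N powr (- (real j - 1) / 2)
                 else real_of_int N powr (- real j / 2)))
    \<and> (\<forall>X Y k. -L \<le> X \<and> X \<le> L \<and> k > 0 \<and> (\<forall>n::int. \<forall>l'\<le>j. (X + real_of_int n * L, Y) \<noteq> (0, - real l' * h)) \<longrightarrow>
        dpart_exists l m (Gq L \<theta> j h k) X Y
      \<and> (\<lambda>N::nat. \<Sum>n\<in>{- int N..int N}. qterm L \<theta> k (dpart l m (Gshift j h k)) X Y n)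
          \<longlonglongrightarrow> dpart l m (Gq L \<theta> j h k) X Y)"
proof (rule conjI; intro allI impI)
  fix M \<delta> :: real assume "M > 0" "\<delta> > 0"
  have e: "(if even j then real_of_int N powr (- (real j - 1) / 2) else real_of_int N powr (- real j / 2))
      = real_of_int N powr (1/2 - real ((j + 1) div 2))" for N :: int
    unfolding half_ceiling_exponent by simp
  \<comment> \<open>The admissible k satisfy 0 < k \<le> k0 + \<delta>. The bounds are uniform down
    to k = 0, so \<delta> may exceed k0.\<close>
  have "k0 + \<delta> > 0" "M \<ge> 0" using \<open>M > 0\<close> \<open>\<delta> > 0\<close> assms by auto
  from qterm_tail_bound[OF assms(1,4-7) this, of \<theta>] obtain D where D: "D > 0"
    "\<And>x y k (N::int). \<bar>x\<bar> \<le> L \<Longrightarrow> \<bar>y\<bar> \<le> M \<Longrightarrow> 0 < k \<Longrightarrow> k \<le> k0 + \<delta> \<Longrightarrow> N > 1 \<Longrightarrow>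
      (\<lambda>n. qterm L \<theta> k (dpart l m (Gshift j h k)) x y n) summable_on {n. \<bar>n\<bar> \<ge> N}
    \<and> norm (\<Sum>\<^sub>\<infinity>n\<in>{n. \<bar>n\<bar> \<ge> N}. qterm L \<theta> k (dpart l m (Gshift j h k)) x y n)
        \<le> D * real_of_int N powr (1/2 - real ((j + 1) div 2))" by blast
  show "\<exists>D>0. \<forall>X Y k. \<forall>N::int.
      -L \<le> X \<and> X \<le> L \<and> -M < Y \<and> Y < M \<and> k > 0 \<and> \<bar>k - k0\<bar> < \<delta> \<and> N > 1 \<longrightarrow>
        (\<lambda>n. qterm L \<theta> k (dpart l m (Gshift j h k)) X Y n) summable_on {n. \<bar>n\<bar> \<ge> N}
      \<and> norm (\<Sum>\<^sub>\<infinity>n\<in>{n. \<bar>n\<bar> \<ge> N}. qterm L \<theta> k (dpart l m (Gshift j h k)) X Y n)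
          \<le> D * (if even j then real_of_int N powr (- (real j - 1) / 2)
                 else real_of_int N powr (- real j / 2))"
    unfolding e
  proof (intro exI[of _ D] conjI[OF D(1)] allI impI, elim conjE)
    fix X Y k :: real and N :: int
    assume "- L \<le> X" "X \<le> L" "- M < Y" "Y < M" "k > 0" "\<bar>k - k0\<bar> < \<delta>" "N > 1"
    thus "(\<lambda>n. qterm L \<theta> k (dpart l m (Gshift j h k)) X Y n) summable_on {n. \<bar>n\<bar> \<ge> N}
      \<and> norm (\<Sum>\<^sub>\<infinity>n\<in>{n. \<bar>n\<bar> \<ge> N}. qterm L \<theta> k (dpart l m (Gshift j h k)) X Y n)
          \<le> D * real_of_int N powr (1/2 - real ((j + 1) div 2))"
      by (intro D(2)) auto
  qed
next
  fix X Y k :: real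
  assume "-L \<le> X \<and> X \<le> L \<and> k > 0 \<and> (\<forall>n::int. \<forall>l'\<le>j. (X + real_of_int n * L, Y) \<noteq> (0, - real l' * h))"
  hence k: "k > 0" and X: "\<bar>X\<bar> \<le> L"
    and ns: "\<forall>n::int. \<forall>l'\<le>j. (X + real_of_int n * L, Y) \<noteq> (0, - real l' * h)" by auto
  note d = dpart_Gq[OF assms(1,5) k assms(4) X ns assms(6,7), of \<theta>]
  show "dpart_exists l m (Gq L \<theta> j h k) X Y
      \<and> (\<lambda>N::nat. \<Sum>n\<in>{- int N..int N}. qterm L \<theta> k (dpart l m (Gshift j h k)) X Y n)
          \<longlonglongrightarrow> dpart l m (Gq L \<theta> j h k) X Y"
    using d(1) symmetric_partial_sums_tendsto_infsum[OF d(2)] unfolding d(3) by blast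
qed

end
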